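(* Let $G$ be a non-discrete locally compact group, and let $\rho \in P_1(G)$ be adapted. Then the sequence of iterated (pointwise) powers $(\rho^n)_{n\ge 1}$ converges to zero in the weak* topology $\sigma(B(G), C^*(G))$.
   Context: For a locally compact group $G$, $B(G)$ denotes the Fourier--Stieltjes algebra: the algebra (under pointwise operations) of all matrix coefficient functions $r \mapsto \langle \pi(r)\xi, \eta\rangle$ of continuous unitary representations $\pi$ of $G$. It is a Banach algebra with the norm $\|\cdot\|_{B(G)}$ coming from its identification with the dual Banach space of the universal group $C^*$-algebra $C^*(G)$, where the duality is determined by $\langle f, \rho\rangle = \int_G f(r)\rho(r)\,dr$ for $f \in L^1(G)$. $P_1(G)$ denotes the set of (continuous) positive definite functions on $G$ of norm one; thus $\rho \in P_1(G)$ means that there are a continuous unitary representation $\pi$ of $G$ on a Hilbert space $H_\pi$ and a unit vector $\xi_\rho \in H_\pi$ with $\rho(r) = \langle \pi(r)\xi_\rho, \xi_\rho\rangle$ for all $r \in G$. An element $\rho \in P_1(G)$ is called adapted if $\rho^{-1}(\{1\}) = \{e\}$, where $e$ is the identity of $G$. *)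

theory Defs
  imports "HOL-Analysis.Analysis" "HOL-Library.Function_Algebras"
begin

text \<open>
  Locally compact groups are types of class \<open>topological_group_add\<close> and \<open>t2_space\<close>, written
  additively although \<open>+\<close> is not assumed commutative: \<open>r + s\<close> is the product of \<open>r\<close> and \<open>s\<close>,
  and \<open>0\<close> is the identity.
\<close>

text \<open>
  Left Haar measures: nonzero left-invariant Radon measures, with outer regularity on all Borel
  sets and inner regularity on open sets (the group need not be \<open>\<sigma>\<close>-compact).
\<close>

definition left_haar_measure :: "'a::{topological_group_add,t2_space} measure \<Rightarrow> bool" where
  "left_haar_measure \<mu> \<longleftrightarrow>
     sets \<mu> = sets borel \<and>
     emeasure \<mu> UNIV \<noteq> 0 \<and>
     (\<forall>s. \<forall>A\<in>sets borel. emeasure \<mu> ((\<lambda>r. s + r) ` A) = emeasure \<mu> A) \<and>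
     (\<forall>K. compact K \<longrightarrow> emeasure \<mu> K < \<infinity>) \<and>
     (\<forall>A\<in>sets borel. emeasure \<mu> A = (INF U\<in>{U. open U \<and> A \<subseteq> U}. emeasure \<mu> U)) \<and>
     (\<forall>U. open U \<longrightarrow> emeasure \<mu> U = (SUP K\<in>{K. compact K \<and> K \<subseteq> U}. emeasure \<mu> K))"


text \<open>
  A complex Hilbert space is a subspace \<open>H\<close> of some complex vector space with an inner product
  (linear in the first argument) that makes \<open>H\<close> complete. Only the values of \<open>ip\<close> on \<open>H\<close> matter.
  Using a subset of the type, rather than the whole type, makes it possible to quantify over many
  Hilbert spaces inside one definition.
\<close>

definition inner_norm :: "('h \<Rightarrow> 'h \<Rightarrow> complex) \<Rightarrow> 'h \<Rightarrow> real" where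
  "inner_norm ip x = sqrt (Re (ip x x))"

locale complex_hilbert_space = vector_space scale
  for scale :: "complex \<Rightarrow> 'h::ab_group_add \<Rightarrow> 'h" +
  fixes H :: "'h set" and ip :: "'h \<Rightarrow> 'h \<Rightarrow> complex"
  assumes subspace_H: "subspace H"
    and ip_add_left: "x \<in> H \<Longrightarrow> y \<in> H \<Longrightarrow> z \<in> H \<Longrightarrow> ip (x + y) z = ip x z + ip y z"
    and ip_scale_left: "x \<in> H \<Longrightarrow> y \<in> H \<Longrightarrow> ip (scale c x) y = c * ip x y"
    and ip_cnj: "x \<in> H \<Longrightarrow> y \<in> H \<Longrightarrow> ip y x = cnj (ip x y)"
    and ip_pos: "x \<in> H \<Longrightarrow> x \<noteq> 0 \<Longrightarrow> 0 < Re (ip x x)"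
    and complete_H:
      "(\<And>n. X n \<in> H) \<Longrightarrow>
       (\<forall>e>0. \<exists>N. \<forall>m\<ge>N. \<forall>n\<ge>N. inner_norm ip (X m - X n) < e) \<Longrightarrow>
       \<exists>l\<in>H. (\<lambda>n. inner_norm ip (X n - l)) \<longlonglongrightarrow> 0"

locale unitary_rep = complex_hilbert_space scale H ip
  for scale :: "complex \<Rightarrow> 'h::ab_group_add \<Rightarrow> 'h" and H and ip +
  fixes \<pi> :: "'a::topological_group_add \<Rightarrow> 'h \<Rightarrow> 'h"
  assumes rep_bij: "bij_betw (\<pi> r) H H"
    and rep_add: "x \<in> H \<Longrightarrow> y \<in> H \<Longrightarrow> \<pi> r (x + y) = \<pi> r x + \<pi> r y"
    and rep_scale: "x \<in> H \<Longrightarrow> \<pi> r (scale c x) = scale c (\<pi> r x)"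
    and rep_ip: "x \<in> H \<Longrightarrow> y \<in> H \<Longrightarrow> ip (\<pi> r x) (\<pi> r y) = ip x y"
    and rep_mult: "x \<in> H \<Longrightarrow> \<pi> (r + s) x = \<pi> r (\<pi> s x)"
    and rep_cont: "x \<in> H \<Longrightarrow> ((\<lambda>r. inner_norm ip (\<pi> r x - \<pi> s x)) \<longlongrightarrow> 0) (at s)"


definition matrix_coefficients ::
    "'h::ab_group_add itself \<Rightarrow> ('a::topological_group_add \<Rightarrow> complex) set" where
  "matrix_coefficients _ =
     {\<rho>. \<exists>scale (H :: 'h set) ip \<pi> \<xi> \<eta>. unitary_rep scale H ip \<pi> \<and> \<xi> \<in> H \<and> \<eta> \<in> H \<and>
           \<rho> = (\<lambda>r. ip (\<pi> r \<xi>) \<eta>)}"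

definition P1 :: "'h::ab_group_add itself \<Rightarrow> ('a::topological_group_add \<Rightarrow> complex) set" where
  "P1 _ =
     {\<rho>. \<exists>scale (H :: 'h set) ip \<pi> \<xi>. unitary_rep scale H ip \<pi> \<and> \<xi> \<in> H \<and> inner_norm ip \<xi> = 1 \<and>
           \<rho> = (\<lambda>r. ip (\<pi> r \<xi>) \<xi>)}"

definition adapted :: "('a::topological_group_add \<Rightarrow> complex) \<Rightarrow> bool" where
  "adapted \<rho> \<longleftrightarrow> \<rho> -` {1} = {0}"

text \<open>
  A definition cannot quantify over types, so \<open>B(G)\<close> and the norm of \<open>C*(G)\<close> range over the
  representations on Hilbert spaces carried by subsets of the type \<open>'a \<Rightarrow> complex\<close>. This loses
  nothing. If \<open>\<xi>\<close> is a cyclic vector of a representation \<open>\<pi>\<close>, then mapping \<open>\<zeta>\<close> to the function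
  \<open>\<lambda>s. \<langle>\<zeta>, \<pi> s \<xi>\<rangle>\<close> is linear and injective, so every cyclic representation is unitarily equivalent
  to one carried by a space of functions on the group. Each matrix coefficient of \<open>\<pi>\<close> is one of a
  cyclic subrepresentation (project \<open>\<eta>\<close> to the closed span of the orbit of \<open>\<xi>\<close>), and the norm of
  \<open>\<pi>(f)\<close> is the supremum of its norms on the cyclic subrepresentations.
\<close>

definition fourier_stieltjes :: "('a::topological_group_add \<Rightarrow> complex) set" where
  "fourier_stieltjes = matrix_coefficients TYPE('a \<Rightarrow> complex)"


text \<open>
  The operator \<open>\<pi>(f) = \<integral> f(r) \<pi>(r) dr\<close>, as a weak integral.
\<close>

definition integrated_rep ::
    "'a measure \<Rightarrow> 'h set \<Rightarrow> ('h \<Rightarrow> 'h \<Rightarrow> complex) \<Rightarrow> ('a \<Rightarrow> 'h \<Rightarrow> 'h) \<Rightarrow> ('a \<Rightarrow> complex) \<Rightarrow> 'h \<Rightarrow> 'h" where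
  "integrated_rep \<mu> H ip \<pi> f \<xi> =
     (THE \<zeta>. \<zeta> \<in> H \<and> (\<forall>\<eta>\<in>H. ip \<zeta> \<eta> = (\<integral>r. f r * ip (\<pi> r \<xi>) \<eta> \<partial>\<mu>)))"

definition operator_norm :: "'h set \<Rightarrow> ('h \<Rightarrow> 'h \<Rightarrow> complex) \<Rightarrow> ('h \<Rightarrow> 'h) \<Rightarrow> real" where
  "operator_norm H ip T = (SUP \<xi>\<in>{\<xi>\<in>H. inner_norm ip \<xi> \<le> 1}. inner_norm ip (T \<xi>))"

definition cstar_norm ::
    "'a::topological_group_add measure \<Rightarrow> ('a \<Rightarrow> complex) \<Rightarrow> real" where
  "cstar_norm \<mu> f =
     Sup {operator_norm H ip (integrated_rep \<mu> H ip \<pi> f) | scale (H :: ('a \<Rightarrow> complex) set) ip \<pi>.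
            unitary_rep scale H ip \<pi>}"

text \<open>
  \<open>C*(G)\<close> as the completion of \<open>L\<^sup>1(G)\<close> in this norm: classes of Cauchy sequences of integrable
  functions. Integrable functions that agree almost everywhere are at distance 0, so they need not
  be identified beforehand.
\<close>

definition cstar_cauchy ::
    "'a::topological_group_add measure \<Rightarrow> (nat \<Rightarrow> 'a \<Rightarrow> complex) set" where
  "cstar_cauchy \<mu> =
     {F. (\<forall>k. integrable \<mu> (F k)) \<and>
         (\<forall>e>0. \<exists>N. \<forall>m\<ge>N. \<forall>n\<ge>N. cstar_norm \<mu> (\<lambda>r. F m r - F n r) < e)}"

definition cstar_equiv ::
    "'a::topological_group_add measure \<Rightarrow> ((nat \<Rightarrow> 'a \<Rightarrow> complex) \<times> (nat \<Rightarrow> 'a \<Rightarrow> complex)) set" where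
  "cstar_equiv \<mu> =
     {(F, F'). F \<in> cstar_cauchy \<mu> \<and> F' \<in> cstar_cauchy \<mu> \<and>
               (\<lambda>k. cstar_norm \<mu> (\<lambda>r. F k r - F' k r)) \<longlonglongrightarrow> 0}"

definition group_cstar ::
    "'a::topological_group_add measure \<Rightarrow> (nat \<Rightarrow> 'a \<Rightarrow> complex) set set" where
  "group_cstar \<mu> = cstar_cauchy \<mu> // cstar_equiv \<mu>"

text \<open>
  The duality between \<open>C*(G)\<close> and \<open>B(G)\<close>: the continuous extension of \<open>\<langle>f, \<rho>\<rangle> = \<integral> f(r) \<rho>(r) dr\<close>
  from \<open>L\<^sup>1(G)\<close> to its completion.
\<close>

definition cstar_pairing ::
    "'a::topological_group_add measure \<Rightarrow> (nat \<Rightarrow> 'a \<Rightarrow> complex) set \<Rightarrow> ('a \<Rightarrow> complex) \<Rightarrow> complex" where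
  "cstar_pairing \<mu> x \<rho> = (THE c. \<forall>F\<in>x. (\<lambda>k. \<integral>r. F k r * \<rho> r \<partial>\<mu>) \<longlonglongrightarrow> c)"

text \<open>
  \<open>\<sigma>(B(G), C*(G))\<close>: the coarsest topology on \<open>B(G)\<close> making all pairings with elements of
  \<open>C*(G)\<close> continuous.
\<close>

definition weak_star_topology ::
    "'a::topological_group_add measure \<Rightarrow> ('a \<Rightarrow> complex) topology" where
  "weak_star_topology \<mu> =
     pullback_topology fourier_stieltjes
       (\<lambda>\<rho>. \<lambda>x\<in>group_cstar \<mu>. cstar_pairing \<mu> x \<rho>)
       (product_topology (\<lambda>_. euclidean) (group_cstar \<mu>))"

end

theory Submission
  imports Defs
begin

text \<open>
  Write \<open>N = {\<bar>\<rho>\<bar> = 1}\<close>, a closed subgroup on which \<open>\<rho>\<close> is an injective character with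
  \<open>\<rho> (s + r) = \<rho> s * \<rho> r\<close> for \<open>s \<in> N\<close> and all \<open>r\<close>. It suffices to show \<open>\<integral> f \<rho>\<^sup>n \<longlonglongrightarrow> 0\<close> for \<open>f\<close> the indicator of
  a set \<open>A\<close> of finite measure, because \<open>\<parallel>\<rho>\<^sup>n\<parallel> = 1\<close>. By regularity, the measure of \<open>(s + A) - A\<close> is small
  for \<open>s\<close> near \<open>0\<close>. If \<open>N\<close> is not a neighbourhood of \<open>0\<close>, there are small \<open>s\<close> for which \<open>s + (A \<inter> N)\<close> and
  \<open>A \<inter> N\<close> are disjoint, so \<open>A \<inter> N\<close> is null and dominated convergence applies. Otherwise, non-discreteness
  and injectivity provide, for every large \<open>n\<close>, a small \<open>s \<in> N\<close> with \<open>\<bar>\<rho> s ^ n - 1\<bar> \<ge> 1\<close>, and comparing the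
  integral with its translate by \<open>s\<close> shows that it is small.

  That \<open>\<rho>\<^sup>n\<close> is a coefficient of a representation on a space of functions on the group follows from the
  Schur product theorem and the Gelfand-Naimark-Segal construction; that its pairing is bounded by the norm of
  \<open>C*(G)\<close> requires the existence of the weak integral, hence the Riesz representation theorem.
\<close>

section \<open>Complex inner product spaces and integrated representations\<close>

text \<open>Minimising over complex \<open>t\<close> gives the discriminant bound.
  \<open>B = 0\<close> is included because the matrices and kernels below are only semidefinite.
  With \<open>A = 0\<close> the bound says that the linear coefficient \<open>z\<close> vanishes,
  which is how the Riesz theorem uses it.\<close>

lemma quadratic_form_nonneg_imp_Cauchy_Schwarz:
  fixes A B :: real and z :: complex
  assumes nonneg: "\<And>t. 0 \<le> A + 2 * Re (t * z) + (cmod t)\<^sup>2 * B" and "0 \<le> B"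
  shows "(cmod z)\<^sup>2 \<le> A * B"
proof (cases "B = 0")
  case False
  then have B: "B > 0" using \<open>0 \<le> B\<close> by simp
  \<comment> \<open>For \<open>B > 0\<close> the minimiser is
    \<open>t = - cnj z / B\<close>.\<close>
  have 1: "Re (- cnj z / of_real B * z) = - (cmod z)\<^sup>2 / B"
    by (simp add: complex_norm_square[symmetric] mult.commute[of "cnj z"] flip: of_real_divide of_real_minus of_real_power)
  have 2: "(cmod (- cnj z / of_real B))\<^sup>2 * B = (cmod z)\<^sup>2 / B"
    using B by (simp add: norm_divide power_divide power2_eq_square)
  have "0 \<le> A + 2 * (- (cmod z)\<^sup>2 / B) + (cmod z)\<^sup>2 / B"
    using nonneg[of "- cnj z / of_real B"] unfolding 1 2 .
  then show ?thesis using B by (simp add: field_simps)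
next
  case True
  have "z = 0"
  proof (rule ccontr)
    assume "z \<noteq> 0"
    \<comment> \<open>With \<open>B = 0\<close> the expression is affine; at
      \<open>- of_real t * cnj z\<close> it equals \<open>- A - 2\<close>, while its value at 0
      shows \<open>0 \<le> A\<close>.\<close>
    define t where "t = (A + 1) / (cmod z)\<^sup>2"
    have "Re (- of_real t * cnj z * z) = - (A + 1)"
      using \<open>z \<noteq> 0\<close> complex_norm_square[of z]
      by (simp add: t_def mult.assoc mult.commute[of "cnj z"] flip: of_real_mult of_real_minus of_real_power)
    with nonneg[of "- of_real t * cnj z"] nonneg[of 0] True show False by simp
  qed
  then show ?thesis using True by simp
qed

text \<open>The axioms of \<open>complex_hilbert_space\<close> without completeness, so that norm
  estimates are available for the kernel space below while its completeness is being proved.\<close>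

locale complex_inner_space = vector_space scale
  for scale :: "complex \<Rightarrow> 'h::ab_group_add \<Rightarrow> 'h" +
  fixes H :: "'h set" and ip :: "'h \<Rightarrow> 'h \<Rightarrow> complex"
  assumes subspace_H: "subspace H"
    and ip_add_left: "x \<in> H \<Longrightarrow> y \<in> H \<Longrightarrow> z \<in> H \<Longrightarrow> ip (x + y) z = ip x z + ip y z"
    and ip_scale_left: "x \<in> H \<Longrightarrow> y \<in> H \<Longrightarrow> ip (scale c x) y = c * ip x y"
    and ip_cnj: "x \<in> H \<Longrightarrow> y \<in> H \<Longrightarrow> ip y x = cnj (ip x y)"
    and ip_pos: "x \<in> H \<Longrightarrow> x \<noteq> 0 \<Longrightarrow> 0 < Re (ip x x)"
begin

lemma H_0 [simp]: "0 \<in> H"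
  and H_add [simp]: "x \<in> H \<Longrightarrow> y \<in> H \<Longrightarrow> x + y \<in> H"
  and H_diff [simp]: "x \<in> H \<Longrightarrow> y \<in> H \<Longrightarrow> x - y \<in> H"
  and H_scale [simp]: "x \<in> H \<Longrightarrow> scale c x \<in> H"
  using subspace_H by (auto simp: subspace_0 subspace_add subspace_diff subspace_scale)

lemma ip_diff_left:
  assumes "x \<in> H" "y \<in> H" "z \<in> H"
  shows "ip (x - y) z = ip x z - ip y z"
  using ip_add_left[of "x - y" y z] assms by simp

lemma ip_add_right:
  assumes "x \<in> H" "y \<in> H" "z \<in> H"
  shows "ip z (x + y) = ip z x + ip z y"
  using assms ip_cnj[of _ z] by (simp add: ip_add_left)

lemma ip_diff_right:
  assumes "x \<in> H" "y \<in> H" "z \<in> H"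
  shows "ip z (x - y) = ip z x - ip z y"
  using assms ip_cnj[of _ z] by (simp add: ip_diff_left)

lemma ip_scale_right:
  assumes "x \<in> H" "y \<in> H"
  shows "ip x (scale c y) = cnj c * ip x y"
  using assms ip_cnj[of _ x] by (simp add: ip_scale_left)

lemma ip_0 [simp]: "x \<in> H \<Longrightarrow> ip 0 x = 0" "x \<in> H \<Longrightarrow> ip x 0 = 0"
  using ip_diff_left[of x x x] ip_diff_right[of x x x] by simp_all

lemmas ip_simps = ip_add_left ip_add_right ip_diff_left ip_diff_right ip_scale_left ip_scale_right

lemma ip_self_nonneg: "x \<in> H \<Longrightarrow> 0 \<le> Re (ip x x)"
  by (cases "x = 0") (auto dest: ip_pos)

lemma ip_self: "x \<in> H \<Longrightarrow> ip x x = of_real ((inner_norm ip x)\<^sup>2)"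
  using ip_cnj[of x x] ip_self_nonneg[of x] by (simp add: inner_norm_def complex_eq_iff)

lemma inner_norm_nonneg [simp]: "x \<in> H \<Longrightarrow> 0 \<le> inner_norm ip x"
  by (simp add: inner_norm_def ip_self_nonneg)

lemma inner_norm_sq: "x \<in> H \<Longrightarrow> (inner_norm ip x)\<^sup>2 = Re (ip x x)"
  by (simp add: inner_norm_def ip_self_nonneg)

lemma inner_norm_eq_0: "x \<in> H \<Longrightarrow> inner_norm ip x = 0 \<Longrightarrow> x = 0"
  using ip_pos[of x] inner_norm_sq[of x] by force

lemma inner_norm_0 [simp]: "inner_norm ip 0 = 0"
  by (simp add: inner_norm_def)

lemma inner_norm_add_sq:
  assumes "x \<in> H" "y \<in> H"
  shows "(inner_norm ip (x + y))\<^sup>2 = (inner_norm ip x)\<^sup>2 + 2 * Re (ip x y) + (inner_norm ip y)\<^sup>2"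
  using assms ip_cnj[of x y] by (simp add: inner_norm_sq ip_simps)

lemma inner_norm_diff_sq:
  assumes "x \<in> H" "y \<in> H"
  shows "(inner_norm ip (x - y))\<^sup>2 = (inner_norm ip x)\<^sup>2 - 2 * Re (ip x y) + (inner_norm ip y)\<^sup>2"
  using assms ip_cnj[of x y] by (simp add: inner_norm_sq ip_simps)

lemma inner_norm_scale:
  assumes "x \<in> H" shows "inner_norm ip (scale c x) = cmod c * inner_norm ip x"
proof -
  have "ip (scale c x) (scale c x) = of_real ((cmod c * inner_norm ip x)\<^sup>2)"
    using assms complex_norm_square[of c]
    by (simp add: ip_simps ip_self[OF assms] power_mult_distrib mult.assoc[symmetric])
  then have "(inner_norm ip (scale c x))\<^sup>2 = (cmod c * inner_norm ip x)\<^sup>2"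
    using assms by (simp add: inner_norm_sq)
  then show ?thesis by (rule power2_eq_imp_eq) (use assms in simp_all)
qed

lemma Cauchy_Schwarz:
  assumes "x \<in> H" "y \<in> H"
  shows "cmod (ip x y) \<le> inner_norm ip x * inner_norm ip y"
proof -
  have "0 \<le> (inner_norm ip x)\<^sup>2 + 2 * Re (t * ip y x) + (cmod t)\<^sup>2 * (inner_norm ip y)\<^sup>2" for t
  proof -
    have "0 \<le> (inner_norm ip (scale t y + x))\<^sup>2" by simp
    then show ?thesis
      using assms ip_cnj[of x y]
        by (simp add: inner_norm_add_sq inner_norm_scale ip_simps power_mult_distrib)
  qed
  then have "(cmod (ip y x))\<^sup>2 \<le> (inner_norm ip x)\<^sup>2 * (inner_norm ip y)\<^sup>2"
    by (rule quadratic_form_nonneg_imp_Cauchy_Schwarz) simp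
  then have "(cmod (ip x y))\<^sup>2 \<le> (inner_norm ip x * inner_norm ip y)\<^sup>2"
    using ip_cnj[OF assms] by (simp add: power_mult_distrib)
  then show ?thesis by (rule power2_le_imp_le) (use assms in simp)
qed

lemma inner_norm_triangle:
  assumes "x \<in> H" "y \<in> H"
  shows "inner_norm ip (x + y) \<le> inner_norm ip x + inner_norm ip y"
proof -
  have "Re (ip x y) \<le> inner_norm ip x * inner_norm ip y"
    using Cauchy_Schwarz[OF assms] complex_Re_le_cmod[of "ip x y"] by linarith
  then have "(inner_norm ip (x + y))\<^sup>2 \<le> (inner_norm ip x + inner_norm ip y)\<^sup>2"
    using assms by (simp add: inner_norm_add_sq power2_sum)
  then show ?thesis by (rule power2_le_imp_le) (use assms in simp)
qed

lemma inner_norm_minus_commute: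
  assumes "x \<in> H" "y \<in> H"
  shows "inner_norm ip (x - y) = inner_norm ip (y - x)"
  using inner_norm_scale[of "x - y" "-1"] assms by simp

lemma inner_norm_triangle3:
  assumes "x \<in> H" "y \<in> H" "z \<in> H"
  shows "inner_norm ip (x - z) \<le> inner_norm ip (x - y) + inner_norm ip (y - z)"
  using inner_norm_triangle[of "x - y" "y - z"] assms by simp

end

sublocale complex_hilbert_space \<subseteq> complex_inner_space scale H ip
  by unfold_locales (fact subspace_H ip_add_left ip_scale_left ip_cnj ip_pos)+

context complex_hilbert_space
begin

text \<open>The representing vector minimises \<open>\<parallel>x\<parallel>\<^sup>2 - 2 Re (l x)\<close>; by the parallelogram law a
  minimising sequence is Cauchy.\<close>

lemma Riesz_representation:
  fixes l :: "'h \<Rightarrow> complex"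
  assumes add: "\<And>x y. x \<in> H \<Longrightarrow> y \<in> H \<Longrightarrow> l (x + y) = l x + l y"
    and scale: "\<And>c x. x \<in> H \<Longrightarrow> l (scale c x) = cnj c * l x"
    and bound: "\<And>x. x \<in> H \<Longrightarrow> cmod (l x) \<le> M * inner_norm ip x"
  shows "\<exists>z\<in>H. \<forall>x\<in>H. ip z x = l x"
proof -
  let ?N = "inner_norm ip"
  define J where "J x = (?N x)\<^sup>2 - 2 * Re (l x)" for x
  have Jlow: "- M\<^sup>2 \<le> J x" if "x \<in> H" for x
  proof -
    have "Re (l x) \<le> M * ?N x"
      using bound[OF that] complex_Re_le_cmod[of "l x"] by linarith
    moreover have "0 \<le> (?N x - M)\<^sup>2" by simp
    ultimately show ?thesis unfolding J_def power2_diff by argo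
  qed
  define m where "m = Inf (J ` H)"
  have bdd: "bdd_below (J ` H)" using Jlow by (auto intro!: bdd_belowI2)
  have m_le: "m \<le> J x" if "x \<in> H" for x
    unfolding m_def using bdd that by (auto intro: cInf_lower)
  have "\<exists>x\<in>H. J x < m + 1 / real (Suc n)" for n
  proof -
    have "J ` H \<noteq> {}" using H_0 by blast
    moreover have "m < m + 1 / real (Suc n)" by simp
    ultimately show ?thesis using cInf_lessD[of "J ` H"] unfolding m_def by blast
  qed
  then obtain X where X: "\<And>n. X n \<in> H" and JX: "\<And>n. J (X n) < m + 1 / real (Suc n)"
    by metis
  have near: "(?N (x - y))\<^sup>2 \<le> 2 * (J x - m) + 2 * (J y - m)" if "x \<in> H" "y \<in> H" for x y
  proof -
    let ?h = "scale (1/2) (x + y)"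
    have "J ?h = (1/4) * (?N (x + y))\<^sup>2 - Re (l x) - Re (l y)"
      using that by (simp add: J_def inner_norm_scale scale add power_mult_distrib power2_eq_square add_divide_distrib)
    moreover have "(?N (x + y))\<^sup>2 + (?N (x - y))\<^sup>2 = 2 * (?N x)\<^sup>2 + 2 * (?N y)\<^sup>2"
      using that by (simp add: inner_norm_add_sq inner_norm_diff_sq)
    moreover have "m \<le> J ?h" using that by (intro m_le) simp
    ultimately show ?thesis unfolding J_def by argo
  qed
  have "\<exists>N. \<forall>i\<ge>N. \<forall>j\<ge>N. ?N (X i - X j) < e" if "e > 0" for e
  proof -
    \<comment> \<open>\<open>near\<close> bounds the squared distance by twice the sum of two gaps
      \<open>J - m\<close>, each below \<open>1 / Suc N\<close>.\<close>
    obtain N where N: "4 / real (Suc N) < e\<^sup>2"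
      using reals_Archimedean[of "e\<^sup>2 / 4"] \<open>e > 0\<close> by (auto simp: field_simps)
    have "?N (X i - X j) < e" if "i \<ge> N" "j \<ge> N" for i j
    proof -
      have "1 / real (Suc i) \<le> 1 / real (Suc N)" "1 / real (Suc j) \<le> 1 / real (Suc N)"
        using that by (auto simp: field_simps)
      then have "(?N (X i - X j))\<^sup>2 < e\<^sup>2"
        using near[OF X X, of i j] JX[of i] JX[of j] N by simp
      then show ?thesis using \<open>e > 0\<close> power2_less_imp_less by fastforce
    qed
    then show ?thesis by blast
  qed
  then obtain z where z: "z \<in> H" and lim: "(\<lambda>n. ?N (X n - z)) \<longlonglongrightarrow> 0"
    using complete_H[of X] X by blast
  have Jz: "J z = m"
  proof (rule antisym)
    \<comment> \<open>Lower semicontinuity of \<open>J\<close> along \<open>X\<close> suffices, so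
      the nonnegative quadratic term is dropped.\<close>
    have *: "J z \<le> J (X n) + 2 * (?N z + M) * ?N (X n - z)" for n
    proof -
      have "(?N (X n))\<^sup>2 = (?N z)\<^sup>2 + 2 * Re (ip z (X n - z)) + (?N (X n - z))\<^sup>2"
        using inner_norm_add_sq[of z "X n - z"] X z by simp
      moreover have "- Re (ip z (X n - z)) \<le> ?N z * ?N (X n - z)"
        using Cauchy_Schwarz[of z "X n - z"] abs_Re_le_cmod[of "ip z (X n - z)"] X z by simp
      moreover have "Re (l (X n)) = Re (l z) + Re (l (X n - z))"
        using add[of z "X n - z"] X z by simp
      moreover have "Re (l (X n - z)) \<le> M * ?N (X n - z)"
        using bound[of "X n - z"] complex_Re_le_cmod[of "l (X n - z)"] X z by simp
      moreover have "0 \<le> (?N (X n - z))\<^sup>2" by simp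
      ultimately show ?thesis unfolding J_def ring_distribs by linarith
    qed
    have "(\<lambda>n. m + 1 / real (Suc n) + 2 * (?N z + M) * ?N (X n - z)) \<longlonglongrightarrow> m + 0 + 2 * (?N z + M) * 0"
      by (intro tendsto_intros lim LIMSEQ_Suc lim_1_over_n)
    moreover have "J z \<le> m + 1 / real (Suc n) + 2 * (?N z + M) * ?N (X n - z)" for n
      using *[of n] JX[of n] by linarith
    ultimately have "J z \<le> m + 0 + 2 * (?N z + M) * 0"
      by (meson LIMSEQ_le_const)
    then show "J z \<le> m" by simp
  qed (rule m_le[OF z])
  have "ip x z = cnj (l x)" if "x \<in> H" for x
  proof -
    \<comment> \<open>First variation: \<open>z\<close> minimises \<open>J\<close>, so
      \<open>J (z + scale t x) - J z\<close> is nonnegative for every complex \<open>t\<close>,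
      which forces its linear coefficient to vanish.\<close>
    have "0 \<le> 0 + 2 * Re (t * (ip x z - cnj (l x))) + (cmod t)\<^sup>2 * (?N x)\<^sup>2" for t
    proof -
      have "J (z + scale t x) = J z + 2 * Re (t * (ip x z - cnj (l x))) + (cmod t)\<^sup>2 * (?N x)\<^sup>2"
        using z that ip_cnj[OF that z]
        by (simp add: J_def inner_norm_add_sq inner_norm_scale power_mult_distrib ip_simps add scale)
           (simp add: algebra_simps)
      moreover have "m \<le> J (z + scale t x)" using z that by (intro m_le) simp
      ultimately show ?thesis using Jz by simp
    qed
    then have "(cmod (ip x z - cnj (l x)))\<^sup>2 \<le> 0 * (?N x)\<^sup>2"
      by (rule quadratic_form_nonneg_imp_Cauchy_Schwarz) simp
    then show ?thesis by simp
  qed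
  then have "\<forall>x\<in>H. ip z x = l x" using ip_cnj[of _ z] z by simp
  then show ?thesis using z by blast
qed

end

section \<open>Matrix coefficients and integrated representations\<close>

context unitary_rep
begin

lemma rep_in_H [simp]: "x \<in> H \<Longrightarrow> \<pi> r x \<in> H"
  using rep_bij[of r] by (auto simp: bij_betw_def)

lemma rep_0 [simp]: "x \<in> H \<Longrightarrow> \<pi> 0 x = x"
  using rep_mult[of x 0 0] rep_bij[of 0] by (auto simp: bij_betw_def inj_on_def)

lemma inner_norm_rep [simp]: "x \<in> H \<Longrightarrow> inner_norm ip (\<pi> r x) = inner_norm ip x"
  by (simp add: inner_norm_def rep_ip)

lemma rep_ip_left: "x \<in> H \<Longrightarrow> y \<in> H \<Longrightarrow> ip (\<pi> r x) y = ip x (\<pi> (- r) y)"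
  using rep_ip[of x "\<pi> (- r) y" r] rep_mult[of y r "- r"] by simp

lemma continuous_on_coefficient:
  assumes "x \<in> H" "y \<in> H"
  shows "continuous_on UNIV (\<lambda>r. ip (\<pi> r x) y)"
proof -
  have "((\<lambda>r. ip (\<pi> r x) y) \<longlongrightarrow> ip (\<pi> s x) y) (at s)" for s
  proof -
    have lim: "((\<lambda>r. inner_norm ip (\<pi> r x - \<pi> s x) * inner_norm ip y) \<longlongrightarrow> 0) (at s)"
      by (rule tendsto_mult_left_zero[OF rep_cont[OF assms(1)]])
    have "cmod (ip (\<pi> r x) y - ip (\<pi> s x) y) \<le> inner_norm ip (\<pi> r x - \<pi> s x) * inner_norm ip y" for r
      using Cauchy_Schwarz[of "\<pi> r x - \<pi> s x" y] assms by (simp add: ip_simps)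
    then have "((\<lambda>r. ip (\<pi> r x) y - ip (\<pi> s x) y) \<longlongrightarrow> 0) (at s)"
      by (intro Lim_null_comparison[OF _ lim] always_eventually allI)
    then show ?thesis by (simp add: LIM_zero_iff)
  qed
  then show ?thesis by (simp add: continuous_on)
qed

lemma cmod_coefficient_le:
  assumes "x \<in> H" "y \<in> H"
  shows "cmod (ip (\<pi> r x) y) \<le> inner_norm ip x * inner_norm ip y"
  using Cauchy_Schwarz[of "\<pi> r x" y] assms by simp

lemma integrable_coefficient:
  assumes "sets \<mu> = sets borel" "integrable \<mu> f" "x \<in> H" "y \<in> H"
  shows "integrable \<mu> (\<lambda>r. f r * ip (\<pi> r x) y)"
proof (rule Bochner_Integration.integrable_bound)
  show "integrable \<mu> (\<lambda>r. cmod (f r) * (inner_norm ip x * inner_norm ip y))"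
    using assms by simp
  have "(\<lambda>r. ip (\<pi> r x) y) \<in> borel_measurable \<mu>"
    using borel_measurable_continuous_onI[OF continuous_on_coefficient[OF assms(3,4)]] assms(1)
    by (simp cong: measurable_cong_sets)
  then show "(\<lambda>r. f r * ip (\<pi> r x) y) \<in> borel_measurable \<mu>"
    using assms(2) by simp
  show "AE r in \<mu>. cmod (f r * ip (\<pi> r x) y) \<le> norm (cmod (f r) * (inner_norm ip x * inner_norm ip y))"
    using cmod_coefficient_le[OF assms(3,4)]
    by (intro AE_I2) (simp add: norm_mult mult_left_mono order_trans[OF _ abs_ge_self])
qed

lemma cmod_integral_coefficient_le:
  assumes "sets \<mu> = sets borel" "integrable \<mu> f" "x \<in> H" "y \<in> H"
  shows "cmod (\<integral>r. f r * ip (\<pi> r x) y \<partial>\<mu>) \<le> (\<integral>r. cmod (f r) \<partial>\<mu>) * inner_norm ip x * inner_norm ip y"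
proof -
  have le: "cmod (f r * ip (\<pi> r x) y) \<le> cmod (f r) * (inner_norm ip x * inner_norm ip y)" for r
    using cmod_coefficient_le[OF assms(3,4)] by (simp add: norm_mult mult_left_mono)
  have "cmod (\<integral>r. f r * ip (\<pi> r x) y \<partial>\<mu>) \<le> (\<integral>r. cmod (f r * ip (\<pi> r x) y) \<partial>\<mu>)"
    by (rule integral_norm_bound)
  also have "\<dots> \<le> (\<integral>r. cmod (f r) * (inner_norm ip x * inner_norm ip y) \<partial>\<mu>)"
    using assms(2)
    by (intro integral_mono le integrable_norm integrable_coefficient assms integrable_mult_left)
  finally show ?thesis by (simp add: mult.assoc)
qed

text \<open>\<open>integrated_rep\<close> is a definite description. Existence is the Riesz theorem
  for the conjugate-linear functional given by integrating \<open>f\<close> against coefficients,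
  which is bounded by the \<open>L^1\<close> norm of \<open>f\<close>; uniqueness is definiteness of
  the inner product.\<close>

lemma integrated_rep:
  assumes \<mu>: "sets \<mu> = sets borel" and f: "integrable \<mu> f" and x: "x \<in> H"
  shows "integrated_rep \<mu> H ip \<pi> f x \<in> H"
    and "y \<in> H \<Longrightarrow> ip (integrated_rep \<mu> H ip \<pi> f x) y = (\<integral>r. f r * ip (\<pi> r x) y \<partial>\<mu>)"
proof -
  let ?l = "\<lambda>y. \<integral>r. f r * ip (\<pi> r x) y \<partial>\<mu>"
  note int = integrable_coefficient[OF \<mu> f x]
  have "\<exists>z\<in>H. \<forall>y\<in>H. ip z y = ?l y"
  proof (rule Riesz_representation)
    fix y y' assume "y \<in> H" "y' \<in> H"
    then show "?l (y + y') = ?l y + ?l y'"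
      using x int by (simp add: ip_simps ring_distribs)
  next
    fix c y assume "y \<in> H"
    then show "?l (scale c y) = cnj c * ?l y"
      using x by (simp add: ip_simps mult.left_commute)
  next
    fix y assume y: "y \<in> H"
    show "cmod (?l y) \<le> ((\<integral>r. cmod (f r) \<partial>\<mu>) * inner_norm ip x) * inner_norm ip y"
      by (rule cmod_integral_coefficient_le[OF \<mu> f x y])
  qed
  then obtain z where z: "z \<in> H" "\<forall>y\<in>H. ip z y = ?l y" by blast
  have uniq: "w = z" if "w \<in> H \<and> (\<forall>y\<in>H. ip w y = ?l y)" for w
  proof -
    have "ip (w - z) (w - z) = 0" using that z by (simp add: ip_diff_left)
    then show ?thesis using ip_pos[of "w - z"] that z by fastforce
  qed
  have "integrated_rep \<mu> H ip \<pi> f x = z"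
    unfolding integrated_rep_def by (rule the_equality) (use z uniq in blast)+
  then show "integrated_rep \<mu> H ip \<pi> f x \<in> H"
    and "y \<in> H \<Longrightarrow> ip (integrated_rep \<mu> H ip \<pi> f x) y = ?l y"
    using z by auto
qed

text \<open>Testing the weak integral against itself bounds its squared norm by a multiple of its
  norm, and one factor cancels. The bound keeps the suprema in \<open>operator_norm\<close> and
  \<open>cstar_norm\<close> finite.\<close>

lemma inner_norm_integrated_rep_le:
  assumes \<mu>: "sets \<mu> = sets borel" and f: "integrable \<mu> f" and x: "x \<in> H"
  shows "inner_norm ip (integrated_rep \<mu> H ip \<pi> f x) \<le> (\<integral>r. cmod (f r) \<partial>\<mu>) * inner_norm ip x"
proof -
  let ?z = "integrated_rep \<mu> H ip \<pi> f x"
  note z = integrated_rep[OF \<mu> f x]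
  have "(inner_norm ip ?z)\<^sup>2 = cmod (\<integral>r. f r * ip (\<pi> r x) ?z \<partial>\<mu>)"
    using z(2)[OF z(1)] z(1) by (metis abs_of_nonneg ip_self norm_of_real zero_le_power2)
  also have "\<dots> \<le> (\<integral>r. cmod (f r) \<partial>\<mu>) * inner_norm ip x * inner_norm ip ?z"
    by (rule cmod_integral_coefficient_le[OF \<mu> f x z(1)])
  finally have *: "inner_norm ip ?z * inner_norm ip ?z
      \<le> ((\<integral>r. cmod (f r) \<partial>\<mu>) * inner_norm ip x) * inner_norm ip ?z"
    by (simp add: power2_eq_square)
  show ?thesis
  proof (cases "inner_norm ip ?z = 0")
    case True
    then show ?thesis using x by (simp add: integral_nonneg)
  next
    case False
    then have "0 < inner_norm ip ?z" using inner_norm_nonneg[OF z(1)] by linarith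
    then show ?thesis using * by simp
  qed
qed

lemma inner_norm_integrated_rep_le_integral:
  assumes "sets \<mu> = sets borel" "integrable \<mu> f" "x \<in> H" "inner_norm ip x \<le> 1"
  shows "inner_norm ip (integrated_rep \<mu> H ip \<pi> f x) \<le> (\<integral>r. cmod (f r) \<partial>\<mu>)"
  using inner_norm_integrated_rep_le[OF assms(1-3)] mult_left_mono[OF assms(4), of "\<integral>r. cmod (f r) \<partial>\<mu>"]
  by (simp add: integral_nonneg)

lemma operator_norm_integrated_rep_le:
  assumes "sets \<mu> = sets borel" "integrable \<mu> f"
  shows "operator_norm H ip (integrated_rep \<mu> H ip \<pi> f) \<le> (\<integral>r. cmod (f r) \<partial>\<mu>)"
  unfolding operator_norm_def
proof (rule cSUP_least)
  have "0 \<in> {\<xi> \<in> H. inner_norm ip \<xi> \<le> 1}" by simp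
  then show "{\<xi> \<in> H. inner_norm ip \<xi> \<le> 1} \<noteq> {}" by blast
qed (use inner_norm_integrated_rep_le_integral[OF assms] in auto)

lemma inner_norm_integrated_rep_le_operator_norm:
  assumes "sets \<mu> = sets borel" "integrable \<mu> f" "x \<in> H" "inner_norm ip x \<le> 1"
  shows "inner_norm ip (integrated_rep \<mu> H ip \<pi> f x)
    \<le> operator_norm H ip (integrated_rep \<mu> H ip \<pi> f)"
  unfolding operator_norm_def
  by (rule cSUP_upper)
    (use assms inner_norm_integrated_rep_le_integral[OF assms(1,2)] in \<open>auto intro!: bdd_aboveI2\<close>)

end

text \<open>The integral is a diagonal coefficient of the integrated operator at a unit vector. The
  representation has to live on functions on the group for its operator norm to occur in the
  supremum \<open>cstar_norm\<close>.\<close>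

lemma cmod_integral_P1_le_cstar_norm:
  fixes \<phi> :: "'a::topological_group_add \<Rightarrow> complex"
  assumes \<mu>: "sets \<mu> = sets borel" and f: "integrable \<mu> f" and \<phi>: "\<phi> \<in> P1 TYPE('a \<Rightarrow> complex)"
  shows "cmod (\<integral>r. f r * \<phi> r \<partial>\<mu>) \<le> cstar_norm \<mu> f"
proof -
  obtain scale and H :: "('a \<Rightarrow> complex) set" and ip \<pi> \<xi> where
    rep: "unitary_rep scale H ip \<pi>" and \<xi>: "\<xi> \<in> H" "inner_norm ip \<xi> = 1"
    and \<phi>_eq: "\<phi> = (\<lambda>r. ip (\<pi> r \<xi>) \<xi>)"
    using \<phi> unfolding P1_def by blast
  interpret unitary_rep scale H ip \<pi> by (fact rep)
  let ?T = "integrated_rep \<mu> H ip \<pi> f"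
  have "cmod (\<integral>r. f r * \<phi> r \<partial>\<mu>) = cmod (ip (?T \<xi>) \<xi>)"
    using integrated_rep(2)[OF \<mu> f \<xi>(1) \<xi>(1)] by (simp add: \<phi>_eq)
  also have "\<dots> \<le> inner_norm ip (?T \<xi>)"
    using Cauchy_Schwarz[OF integrated_rep(1)[OF \<mu> f \<xi>(1)] \<xi>(1)] \<xi> by simp
  also have "\<dots> \<le> operator_norm H ip ?T"
    using \<xi> by (intro inner_norm_integrated_rep_le_operator_norm[OF \<mu> f]) simp_all
  also have "\<dots> \<le> cstar_norm \<mu> f"
    unfolding cstar_norm_def
  proof (rule cSup_upper)
    \<comment> \<open>A real \<open>Sup\<close> is an upper bound only for a bounded set; the
      \<open>L^1\<close> norm of \<open>f\<close> bounds all the operator norms at once.\<close>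
    show "bdd_above {operator_norm H ip (integrated_rep \<mu> H ip \<pi> f) | scale (H :: ('a \<Rightarrow> complex) set) ip \<pi>.
            unitary_rep scale H ip \<pi>}"
      using unitary_rep.operator_norm_integrated_rep_le[OF _ \<mu> f]
      by (intro bdd_aboveI[of _ "\<integral>r. cmod (f r) \<partial>\<mu>"]) blast
  qed (use rep in blast)
  finally show ?thesis .
qed

section \<open>The Schur product theorem\<close>

definition psd_matrix :: "nat \<Rightarrow> (nat \<Rightarrow> nat \<Rightarrow> complex) \<Rightarrow> bool" where
  "psd_matrix n a \<longleftrightarrow>
     (\<forall>i<n. \<forall>j<n. a j i = cnj (a i j)) \<and>
     (\<forall>c. 0 \<le> Re (\<Sum>i<n. \<Sum>j<n. c i * cnj (c j) * a i j))"

lemma psd_matrix_herm: "psd_matrix n a \<Longrightarrow> i < n \<Longrightarrow> j < n \<Longrightarrow> a j i = cnj (a i j)"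
  unfolding psd_matrix_def by blast

lemma psd_matrix_nonneg: "psd_matrix n a \<Longrightarrow> 0 \<le> Re (\<Sum>i<n. \<Sum>j<n. c i * cnj (c j) * a i j)"
  unfolding psd_matrix_def by blast

lemma psd_matrix_SucD:
  assumes "psd_matrix (Suc n) a" shows "psd_matrix n a"
  unfolding psd_matrix_def
proof (intro conjI allI impI)
  fix c :: "nat \<Rightarrow> complex"
  have eq: "(\<Sum>i<Suc n. \<Sum>j<Suc n. (c(n := 0)) i * cnj ((c(n := 0)) j) * a i j)
      = (\<Sum>i<n. \<Sum>j<n. c i * cnj (c j) * a i j)"
    by simp
  show "0 \<le> Re (\<Sum>i<n. \<Sum>j<n. c i * cnj (c j) * a i j)"
    using psd_matrix_nonneg[OF assms, of "c(n := 0)"] unfolding eq .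
next
  fix i j assume "i < n" "j < n"
  then show "a j i = cnj (a i j)"
    using psd_matrix_herm[OF assms, of i j] by simp
qed

lemma sum_indicator_mult:
  fixes f :: "nat \<Rightarrow> complex"
  assumes "n < m"
  shows "(\<Sum>i<m. (if i = n then t else 0) * f i) = t * f n"
    and "(\<Sum>i<m. cnj (if i = n then t else 0) * f i) = cnj t * f n"
  using assms by (simp_all add: if_distrib[of "\<lambda>x. x * _"] if_distrib[of cnj] cong: if_cong)

lemma psd_matrix_diag_nonneg:
  assumes "psd_matrix m a" "n < m" shows "0 \<le> Re (a n n)"
proof -
  have "(\<Sum>i<m. \<Sum>j<m. (if i = n then 1 else 0) * cnj (if j = n then 1 else 0) * a i j) = a n n"
    using sum_indicator_mult[OF assms(2), of 1]
    by (simp only: mult.assoc sum_distrib_left[symmetric] complex_cnj_one mult_1_left)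
  then show ?thesis
    using psd_matrix_nonneg[OF assms(1), of "\<lambda>i. if i = n then 1 else 0"] by (simp only:)
qed

text \<open>Cauchy-Schwarz for the semi-inner product defined by \<open>a\<close>, applied to
  \<open>c\<close> and the \<open>n\<close>-th unit vector: the quadratic form is evaluated at
  \<open>c\<close> plus \<open>t\<close> times that unit vector.\<close>

lemma psd_matrix_Cauchy_Schwarz:
  assumes a: "psd_matrix m a" and n: "n < m"
  shows "(cmod (\<Sum>i<m. c i * a i n))\<^sup>2
    \<le> Re (\<Sum>i<m. \<Sum>j<m. c i * cnj (c j) * a i j) * Re (a n n)"
proof -
  let ?S = "\<Sum>i<m. c i * a i n" and ?Q = "\<lambda>c. \<Sum>i<m. \<Sum>j<m. c i * cnj (c j) * a i j"
  have herm: "a n j = cnj (a j n)" if "j < m" for j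
    using psd_matrix_herm[OF a that n] .
  have "0 \<le> Re (?Q c) + 2 * Re (t * cnj ?S) + (cmod t)\<^sup>2 * Re (a n n)" for t
  proof -
    define e where "e i = (if i = n then t else 0)" for i
    have pick: "(\<Sum>i<m. e i * f i) = t * f n" "(\<Sum>i<m. cnj (e i) * f i) = cnj t * f n" for f
      unfolding e_def by (rule sum_indicator_mult[OF n])+
    have "?Q (\<lambda>i. c i + e i) = ?Q c + (\<Sum>i<m. c i * (\<Sum>j<m. cnj (e j) * a i j))
        + (\<Sum>i<m. e i * (\<Sum>j<m. cnj (c j) * a i j)) + (\<Sum>i<m. e i * (\<Sum>j<m. cnj (e j) * a i j))"
      by (simp add: ring_distribs sum.distrib sum_distrib_left mult.assoc)
    also have "\<dots> = ?Q c + cnj t * ?S + t * (\<Sum>j<m. cnj (c j) * a n j) + t * cnj t * a n n"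
      by (simp only: pick) (simp add: sum_distrib_left mult_ac)
    also have "(\<Sum>j<m. cnj (c j) * a n j) = cnj ?S"
      using herm by simp
    finally have "?Q (\<lambda>i. c i + e i) = ?Q c + cnj t * ?S + t * cnj ?S + t * cnj t * a n n" .
    moreover have "Re (cnj t * ?S) = Re (t * cnj ?S)"
      by (metis complex_cnj_cnj complex_cnj_mult cnj.simps(1))
    moreover have "Re (t * cnj t * a n n) = (cmod t)\<^sup>2 * Re (a n n)"
      by (simp flip: complex_norm_square of_real_power)
    ultimately have "Re (?Q (\<lambda>i. c i + e i)) = Re (?Q c) + 2 * Re (t * cnj ?S) + (cmod t)\<^sup>2 * Re (a n n)"
      by (simp only: plus_complex.sel)
    then show ?thesis
      using psd_matrix_nonneg[OF a, of "\<lambda>i. c i + e i"] by (simp only:)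
  qed
  then have "(cmod (cnj ?S))\<^sup>2 \<le> Re (?Q c) * Re (a n n)"
    by (rule quadratic_form_nonneg_imp_Cauchy_Schwarz) (rule psd_matrix_diag_nonneg[OF assms])
  then show ?thesis by (simp only: complex_mod_cnj)
qed

text \<open>A zero on the diagonal kills its column by Cauchy-Schwarz for the \<open>i\<close>-th
  unit vector.\<close>

lemma psd_matrix_diag:
  assumes "psd_matrix m a" "n < m"
  shows "a n n = of_real (Re (a n n))"
    and "a n n = 0 \<Longrightarrow> i < m \<Longrightarrow> a i n = 0"
proof -
  show "a n n = of_real (Re (a n n))"
    using psd_matrix_herm[OF assms(1,2,2)] by (simp add: complex_eq_iff)
  assume "a n n = 0" "i < m"
  then show "a i n = 0"
    using psd_matrix_Cauchy_Schwarz[OF assms, of "\<lambda>l. if l = i then 1 else 0"]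
    by (simp only: sum_indicator_mult[OF \<open>i < m\<close>]) simp
qed

text \<open>The form of the complement is that of \<open>a\<close> minus the squared modulus of the
  pairing of \<open>c\<close> with column \<open>n\<close>, divided by \<open>a n n\<close>;
  Cauchy-Schwarz bounds the subtracted term. If \<open>a n n = 0\<close>, division by zero yields 0
  and the complement is \<open>a\<close> itself.\<close>

lemma psd_matrix_Schur_complement:
  assumes a: "psd_matrix m a" and n: "n < m"
  shows "psd_matrix m (\<lambda>i j. a i j - a i n * a n j / a n n)"
  unfolding psd_matrix_def
proof (intro conjI allI impI)
  fix i j assume "i < m" "j < m"
  then show "a j i - a j n * a n i / a n n = cnj (a i j - a i n * a n j / a n n)"
    using psd_matrix_herm[OF a, of i j] psd_matrix_herm[OF a, of n i]
      psd_matrix_herm[OF a, of n j] psd_matrix_herm[OF a n n] n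
    by (simp add: mult.commute)
next
  fix c
  let ?S = "\<Sum>i<m. c i * a i n" and ?Q = "\<Sum>i<m. \<Sum>j<m. c i * cnj (c j) * a i j"
  define \<alpha> where "\<alpha> = Re (a n n)"
  note diag = psd_matrix_diag(1)[OF a n, folded \<alpha>_def] psd_matrix_diag_nonneg[OF a n, folded \<alpha>_def]
  have "cnj ?S = (\<Sum>j<m. cnj (c j) * a n j)"
    using psd_matrix_herm[OF a _ n] by simp
  then have "?S * cnj ?S / a n n = (\<Sum>i<m. \<Sum>j<m. c i * a i n * (cnj (c j) * a n j) / a n n)"
    by (simp add: sum_product sum_divide_distrib)
  then have "(\<Sum>i<m. \<Sum>j<m. c i * cnj (c j) * (a i j - a i n * a n j / a n n))
      = ?Q - ?S * cnj ?S / a n n"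
    by (simp add: right_diff_distrib sum_subtractf mult_ac)
  moreover have "?S * cnj ?S / a n n = of_real ((cmod ?S)\<^sup>2 / \<alpha>)"
    using diag(1) by (simp only: complex_norm_square[symmetric] of_real_divide)
  moreover have "(cmod ?S)\<^sup>2 / \<alpha> \<le> Re ?Q"
  proof (cases "\<alpha> = 0")
    case True
    then show ?thesis using psd_matrix_nonneg[OF a, of c] by (simp only: div_by_0)
  next
    case False
    then have "0 < \<alpha>" using diag(2) by simp
    then show ?thesis
      using psd_matrix_Cauchy_Schwarz[OF a n, of c, folded \<alpha>_def] by (simp only: pos_divide_le_eq)
  qed
  ultimately show "0 \<le> Re (\<Sum>i<m. \<Sum>j<m. c i * cnj (c j) * (a i j - a i n * a n j / a n n))"
    by (simp only: minus_complex.sel Re_complex_of_real diff_ge_0_iff_ge)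
qed

text \<open>Schur product theorem. Subtracting the rank-one part of \<open>a\<close> through its last index reduces
  the size of the remaining matrix, and a rank-one matrix only rescales the vector \<open>c\<close> in the
  quadratic form of \<open>b\<close>.\<close>

lemma psd_matrix_mult:
  "psd_matrix n a \<Longrightarrow> psd_matrix n b \<Longrightarrow> psd_matrix n (\<lambda>i j. a i j * b i j)"
proof (induction n arbitrary: a)
  case 0
  then show ?case by (simp add: psd_matrix_def)
next
  case (Suc n)
  note a = Suc.prems(1) and b = Suc.prems(2)
  let ?a' = "\<lambda>i j. a i j - a i n * a n j / a n n"
  have n: "n < Suc n" by simp
  define \<alpha> where "\<alpha> = Re (a n n)"
  note diag = psd_matrix_diag(1)[OF a n, folded \<alpha>_def] psd_matrix_diag_nonneg[OF a n, folded \<alpha>_def]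
  have "psd_matrix n (\<lambda>i j. ?a' i j * b i j)"
    using Suc.IH[of ?a'] psd_matrix_SucD[OF psd_matrix_Schur_complement[OF a n]] psd_matrix_SucD[OF b]
    by blast
  note psd' = psd_matrix_nonneg[OF this]
  \<comment> \<open>The complement vanishes in its last row and column, also for
    \<open>a n n = 0\<close>, where the column of \<open>a\<close> is already zero. Its form thus
    sees only the first \<open>n\<close> entries of \<open>c\<close>, and the induction hypothesis
    applies.\<close>
  have a'0: "?a' i n = 0" "?a' n i = 0" if "i < Suc n" for i
    using psd_matrix_diag(2)[OF a n _ that] psd_matrix_herm[OF a that n] by auto
  have "0 \<le> Re (\<Sum>i<Suc n. \<Sum>j<Suc n. c i * cnj (c j) * (a i j * b i j))" for c
  proof -
    have "(\<Sum>i<Suc n. \<Sum>j<Suc n. c i * cnj (c j) * (a i j * b i j))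
        = (\<Sum>i<Suc n. \<Sum>j<Suc n. c i * cnj (c j) * (?a' i j * b i j))
        + (\<Sum>i<Suc n. \<Sum>j<Suc n. c i * cnj (c j) * (a i n * a n j / a n n * b i j))"
      unfolding sum.distrib[symmetric] by (intro sum.cong refl) (simp add: algebra_simps)
    also have "(\<Sum>i<Suc n. \<Sum>j<Suc n. c i * cnj (c j) * (?a' i j * b i j))
        = (\<Sum>i<n. \<Sum>j<n. c i * cnj (c j) * (?a' i j * b i j))"
      using a'0 by (simp del: right_minus_eq)
    also have "(\<Sum>i<Suc n. \<Sum>j<Suc n. c i * cnj (c j) * (a i n * a n j / a n n * b i j))
        = (\<Sum>i<Suc n. \<Sum>j<Suc n. (c i * a i n) * cnj (c j * a j n) * b i j) / a n n"
      unfolding sum_divide_distrib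
    proof (intro sum.cong refl)
      fix i j assume "j \<in> {..<Suc n}"
      then have "a n j = cnj (a j n)" using psd_matrix_herm[OF a _ n, of j] by simp
      then show "c i * cnj (c j) * (a i n * a n j / a n n * b i j)
          = c i * a i n * cnj (c j * a j n) * b i j / a n n"
        by (simp only: complex_cnj_mult times_divide_eq_left times_divide_eq_right mult_ac)
    qed
    finally have "Re (\<Sum>i<Suc n. \<Sum>j<Suc n. c i * cnj (c j) * (a i j * b i j))
        = Re (\<Sum>i<n. \<Sum>j<n. c i * cnj (c j) * (?a' i j * b i j))
        + Re (\<Sum>i<Suc n. \<Sum>j<Suc n. (c i * a i n) * cnj (c j * a j n) * b i j) / \<alpha>"
      using diag(1) by (simp only: plus_complex.sel Re_divide_of_real)
    then show ?thesis
      using add_nonneg_nonneg[OF psd'[of c] divide_nonneg_nonneg[OF psd_matrix_nonneg[OF b] diag(2)],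
          of "\<lambda>i. c i * a i n"] by (simp only:)
  qed
  moreover have "a j i * b j i = cnj (a i j * b i j)" if "i < Suc n" "j < Suc n" for i j
    using psd_matrix_herm[OF a that] psd_matrix_herm[OF b that] by simp
  ultimately show ?case unfolding psd_matrix_def by blast
qed

text \<open>A list of pairs \<open>(a, x)\<close> stands for the formal linear combination of the points \<open>x\<close> with
  coefficients \<open>a\<close>.\<close>

definition kernel_form :: "('a \<Rightarrow> 'a \<Rightarrow> complex) \<Rightarrow> (complex \<times> 'a) list \<Rightarrow> (complex \<times> 'a) list \<Rightarrow> complex" where
  "kernel_form k c d = (\<Sum>(a, x)\<leftarrow>c. \<Sum>(b, y)\<leftarrow>d. a * cnj b * k x y)"

definition psd_kernel :: "('a \<Rightarrow> 'a \<Rightarrow> complex) \<Rightarrow> bool" where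
  "psd_kernel k \<longleftrightarrow> (\<forall>x y. k y x = cnj (k x y)) \<and> (\<forall>c. 0 \<le> Re (kernel_form k c c))"

lemma kernel_form_conv_sum:
  "kernel_form k c d =
     (\<Sum>i<length c. \<Sum>j<length d. fst (c ! i) * cnj (fst (d ! j)) * k (snd (c ! i)) (snd (d ! j)))"
  by (simp add: kernel_form_def sum_list_sum_nth case_prod_beta atLeast0LessThan)

text \<open>Lists suit the construction of a vector space, matrices the Schur product. Points may
  repeat in both; hermitian symmetry is read off from matrices of size 2.\<close>

lemma psd_kernel_iff_psd_matrix:
  "psd_kernel k \<longleftrightarrow> (\<forall>n x. psd_matrix n (\<lambda>i j. k (x i) (x j)))"
proof (intro iffI allI)
  fix n x assume k: "psd_kernel k"
  show "psd_matrix n (\<lambda>i j. k (x i) (x j))"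
    unfolding psd_matrix_def
  proof (intro conjI allI impI)
    fix c
    have "kernel_form k (map (\<lambda>i. (c i, x i)) [0..<n]) (map (\<lambda>i. (c i, x i)) [0..<n])
        = (\<Sum>i<n. \<Sum>j<n. c i * cnj (c j) * k (x i) (x j))"
      by (simp add: kernel_form_conv_sum)
    then show "0 \<le> Re (\<Sum>i<n. \<Sum>j<n. c i * cnj (c j) * k (x i) (x j))"
      using k unfolding psd_kernel_def by metis
  qed (use k in \<open>unfold psd_kernel_def, blast\<close>)
next
  assume k: "\<forall>n x. psd_matrix n (\<lambda>i j. k (x i) (x j))"
  show "psd_kernel k"
    unfolding psd_kernel_def
  proof (intro conjI allI)
    fix x y
    show "k y x = cnj (k x y)"
      using psd_matrix_herm[OF k[rule_format, of 2 "\<lambda>i. if i = 0 then x else y"], of 0 1] by simp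
  next
    fix c
    show "0 \<le> Re (kernel_form k c c)"
      unfolding kernel_form_conv_sum
      by (rule psd_matrix_nonneg[OF k[rule_format, of "length c" "\<lambda>i. snd (c ! i)"]])
  qed
qed

lemma psd_kernel_mult: "psd_kernel k \<Longrightarrow> psd_kernel l \<Longrightarrow> psd_kernel (\<lambda>x y. k x y * l x y)"
  unfolding psd_kernel_iff_psd_matrix using psd_matrix_mult by blast

lemma psd_kernel_power:
  assumes "psd_kernel k" shows "0 < n \<Longrightarrow> psd_kernel (\<lambda>x y. k x y ^ n)"
proof (induction n rule: nat_induct_non_zero)
  case (Suc n)
  then show ?case using psd_kernel_mult[OF assms] by simp
qed (use assms in simp)

section \<open>The Hilbert space of a positive definite kernel\<close>

lemma kernel_form_Nil [simp]: "kernel_form k [] d = 0" "kernel_form k c [] = 0"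
  by (simp_all add: kernel_form_def split_def)

lemma kernel_form_append [simp]:
  "kernel_form k (c @ c') d = kernel_form k c d + kernel_form k c' d"
  "kernel_form k c (d @ d') = kernel_form k c d + kernel_form k c d'"
  by (simp_all add: kernel_form_def split_def sum_list_addf)

lemma kernel_form_Cons: "kernel_form k (p # c) d = kernel_form k [p] d + kernel_form k c d"
  "kernel_form k c (p # d) = kernel_form k c [p] + kernel_form k c d"
  using kernel_form_append(1)[of k "[p]" c d] kernel_form_append(2)[of k c "[p]" d] by simp_all

definition lin_scale :: "complex \<Rightarrow> (complex \<times> 'a) list \<Rightarrow> (complex \<times> 'a) list" where
  "lin_scale z c = map (\<lambda>(a, x). (z * a, x)) c"

text \<open>Formal subtraction without cancellation: \<open>lin_diff c c\<close> is in general not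
  \<open>[]\<close>. Identities between combinations hold after applying \<open>kernel_form\<close>,
  and \<open>seminorm_cong\<close> carries them over to seminorms.\<close>

definition lin_diff :: "(complex \<times> 'a) list \<Rightarrow> (complex \<times> 'a) list \<Rightarrow> (complex \<times> 'a) list" where
  "lin_diff c d = c @ lin_scale (-1) d"

lemma kernel_form_scale [simp]:
  "kernel_form k (lin_scale z c) d = z * kernel_form k c d"
  "kernel_form k c (lin_scale z d) = cnj z * kernel_form k c d"
  by (simp_all add: kernel_form_def lin_scale_def split_def o_def sum_list_const_mult[symmetric] mult_ac)

lemma kernel_form_diff [simp]:
  "kernel_form k (lin_diff c c') d = kernel_form k c d - kernel_form k c' d"
  "kernel_form k c (lin_diff d d') = kernel_form k c d - kernel_form k c d'"
  by (simp_all add: lin_diff_def)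

lemma kernel_form_herm:
  assumes "\<And>x y. k y x = cnj (k x y)"
  shows "kernel_form k d c = cnj (kernel_form k c d)"
proof (induction c)
  case (Cons p c)
  have "kernel_form k d [p] = cnj (kernel_form k [p] d)"
  proof (induction d)
    case (Cons q d)
    have "kernel_form k [q] [p] = cnj (kernel_form k [p] [q])"
      using assms[of "snd q" "snd p"] by (simp add: kernel_form_def case_prod_beta)
    with Cons show ?case
      using kernel_form_Cons(1)[of k q d "[p]"] kernel_form_Cons(2)[of k "[p]" q d] by simp
  qed simp
  with Cons show ?case
    using kernel_form_Cons(1)[of k p c d] kernel_form_Cons(2)[of k d p c] by simp
qed simp

definition fun_scale :: "complex \<Rightarrow> ('a \<Rightarrow> complex) \<Rightarrow> 'a \<Rightarrow> complex" where
  "fun_scale z F = (\<lambda>s. z * F s)"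

lemma vector_space_fun_scale: "vector_space fun_scale"
  by unfold_locales (auto simp: fun_scale_def fun_eq_iff algebra_simps)

locale psd_kernel_space =
  fixes k :: "'a \<Rightarrow> 'a \<Rightarrow> complex"
  assumes psd: "psd_kernel k"
begin

abbreviation form where "form \<equiv> kernel_form k"

definition seminorm :: "(complex \<times> 'a) list \<Rightarrow> real" where
  "seminorm c = sqrt (Re (form c c))"

lemma form_herm: "form d c = cnj (form c d)"
  using psd by (intro kernel_form_herm) (unfold psd_kernel_def, blast)

lemma form_nonneg: "0 \<le> Re (form c c)"
  using psd unfolding psd_kernel_def by blast

lemma seminorm_nonneg [simp]: "0 \<le> seminorm c"
  by (simp add: seminorm_def form_nonneg)

lemma seminorm_sq: "(seminorm c)\<^sup>2 = Re (form c c)"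
  by (simp add: seminorm_def form_nonneg)

lemma form_self: "form c c = of_real ((seminorm c)\<^sup>2)"
  using form_herm[of c c] by (simp add: seminorm_sq complex_eq_iff)

lemma seminorm_cong: "form c c = form d d \<Longrightarrow> seminorm c = seminorm d"
  by (simp add: seminorm_def)

lemma seminorm_scale: "seminorm (lin_scale z c) = cmod z * seminorm c"
proof -
  have "form (lin_scale z c) (lin_scale z c) = of_real ((cmod z * seminorm c)\<^sup>2)"
    using complex_norm_square[of z] form_self[of c] by (simp add: power_mult_distrib mult.assoc[symmetric])
  then have "(seminorm (lin_scale z c))\<^sup>2 = (cmod z * seminorm c)\<^sup>2"
    by (simp add: seminorm_sq)
  then show ?thesis by (rule power2_eq_imp_eq) simp_all
qed

lemma seminorm_append_sq: "(seminorm (c @ d))\<^sup>2 = (seminorm c)\<^sup>2 + 2 * Re (form c d) + (seminorm d)\<^sup>2"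
  using form_herm[of d c] by (simp add: seminorm_sq)

lemma form_Cauchy_Schwarz: "cmod (form c d) \<le> seminorm c * seminorm d"
proof -
  have "0 \<le> (seminorm d)\<^sup>2 + 2 * Re (t * form c d) + (cmod t)\<^sup>2 * (seminorm c)\<^sup>2" for t
  proof -
    have "0 \<le> (seminorm (lin_scale t c @ d))\<^sup>2" by simp
    also have "\<dots> = (cmod t * seminorm c)\<^sup>2 + 2 * Re (t * form c d) + (seminorm d)\<^sup>2"
      by (simp only: seminorm_append_sq seminorm_scale kernel_form_scale)
    finally show ?thesis by (simp add: power_mult_distrib)
  qed
  then have "(cmod (form c d))\<^sup>2 \<le> (seminorm d)\<^sup>2 * (seminorm c)\<^sup>2"
    by (rule quadratic_form_nonneg_imp_Cauchy_Schwarz) simp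
  then have "(cmod (form c d))\<^sup>2 \<le> (seminorm c * seminorm d)\<^sup>2"
    by (simp add: power_mult_distrib mult.commute)
  then show ?thesis by (rule power2_le_imp_le) simp
qed

lemma seminorm_append_le: "seminorm (c @ d) \<le> seminorm c + seminorm d"
proof -
  have "Re (form c d) \<le> seminorm c * seminorm d"
    using form_Cauchy_Schwarz[of c d] complex_Re_le_cmod[of "form c d"] by linarith
  then have "(seminorm (c @ d))\<^sup>2 \<le> (seminorm c + seminorm d)\<^sup>2"
    unfolding seminorm_append_sq power2_sum by linarith
  then show ?thesis by (rule power2_le_imp_le) simp
qed

lemma seminorm_le_diff: "seminorm c \<le> seminorm (lin_diff c d) + seminorm d"
proof -
  have "seminorm c = seminorm (lin_diff c d @ d)"
    by (rule seminorm_cong) simp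
  then show ?thesis using seminorm_append_le by simp
qed

lemma seminorm_diff_commute: "seminorm (lin_diff c d) = seminorm (lin_diff d c)"
  by (rule seminorm_cong) simp

lemma form_diff_le:
  "cmod (form c d - form c' d') \<le> seminorm (lin_diff c c') * seminorm d + seminorm c' * seminorm (lin_diff d d')"
proof -
  have "form c d - form c' d' = form (lin_diff c c') d + form c' (lin_diff d d')" by simp
  also have "cmod \<dots> \<le> seminorm (lin_diff c c') * seminorm d + seminorm c' * seminorm (lin_diff d d')"
    by (intro norm_triangle_mono form_Cauchy_Schwarz)
  finally show ?thesis .
qed

section \<open>Cauchy sequences of formal combinations and their pointwise limits\<close>

definition seminorm_Cauchy :: "(nat \<Rightarrow> (complex \<times> 'a) list) \<Rightarrow> bool" where
  "seminorm_Cauchy X \<longleftrightarrow> (\<forall>e>0. \<exists>N. \<forall>m\<ge>N. \<forall>n\<ge>N. seminorm (lin_diff (X m) (X n)) < e)"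

lemma seminorm_CauchyD: "seminorm_Cauchy X \<Longrightarrow> 0 < e \<Longrightarrow> \<exists>N. \<forall>m\<ge>N. \<forall>n\<ge>N. seminorm (lin_diff (X m) (X n)) < e"
  by (simp add: seminorm_Cauchy_def)

lemma seminorm_Cauchy_bounded:
  assumes "seminorm_Cauchy X" obtains M where "0 < M" "\<And>n. seminorm (X n) \<le> M"
proof -
  have "Cauchy (\<lambda>n. seminorm (X n))"
  proof (rule metric_CauchyI)
    fix e :: real assume "0 < e"
    then obtain N where "\<forall>m\<ge>N. \<forall>n\<ge>N. seminorm (lin_diff (X m) (X n)) < e"
      using seminorm_CauchyD[OF assms] by blast
    moreover have "dist (seminorm (X m)) (seminorm (X n)) \<le> seminorm (lin_diff (X m) (X n))" for m n
      using seminorm_le_diff[of "X m" "X n"] seminorm_le_diff[of "X n" "X m"] seminorm_diff_commute[of "X m" "X n"]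
      by (simp add: dist_real_def)
    ultimately show "\<exists>N. \<forall>m\<ge>N. \<forall>n\<ge>N. dist (seminorm (X m)) (seminorm (X n)) < e"
      using order.strict_trans1 by blast
  qed
  then have "Bseq (\<lambda>n. seminorm (X n))"
    using Cauchy_convergent convergent_imp_Bseq by blast
  then obtain M where "0 < M" "\<forall>n. norm (seminorm (X n)) \<le> M"
    unfolding Bseq_def by blast
  then show ?thesis using that[of M] by simp
qed

lemma convergent_form:
  assumes "seminorm_Cauchy X" "seminorm_Cauchy Y"
  shows "convergent (\<lambda>n. form (X n) (Y n))"
proof (rule Cauchy_convergent, rule metric_CauchyI)
  fix e :: real assume "0 < e"
  obtain M where M: "0 < M" "\<And>n. seminorm (X n) \<le> M" using seminorm_Cauchy_bounded[OF assms(1)] by blast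
  obtain M' where M': "0 < M'" "\<And>n. seminorm (Y n) \<le> M'" using seminorm_Cauchy_bounded[OF assms(2)] by blast
  obtain N where N: "\<forall>m\<ge>N. \<forall>n\<ge>N. seminorm (lin_diff (X m) (X n)) < e / (2 * M')"
    using seminorm_CauchyD[OF assms(1), of "e / (2 * M')"] \<open>0 < e\<close> M' by auto
  obtain N' where N': "\<forall>m\<ge>N'. \<forall>n\<ge>N'. seminorm (lin_diff (Y m) (Y n)) < e / (2 * M)"
    using seminorm_CauchyD[OF assms(2), of "e / (2 * M)"] \<open>0 < e\<close> M by auto
  have "dist (form (X m) (Y m)) (form (X n) (Y n)) < e"
    if "m \<ge> max N N'" "n \<ge> max N N'" for m n
  proof -
    have "dist (form (X m) (Y m)) (form (X n) (Y n))
        \<le> seminorm (lin_diff (X m) (X n)) * seminorm (Y m) + seminorm (X n) * seminorm (lin_diff (Y m) (Y n))"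
      using form_diff_le by (simp add: dist_norm)
    also have "\<dots> \<le> seminorm (lin_diff (X m) (X n)) * M' + M * seminorm (lin_diff (Y m) (Y n))"
      using M(2) M'(2) by (intro add_mono mult_left_mono mult_right_mono) auto
    also have "\<dots> < e / (2 * M') * M' + M * (e / (2 * M))"
      using N N' that M(1) M'(1) by (intro add_strict_mono mult_strict_right_mono mult_strict_left_mono) auto
    also have "\<dots> = e" using M(1) M'(1) by (simp add: field_simps)
    finally show ?thesis .
  qed
  then show "\<exists>N. \<forall>m\<ge>N. \<forall>n\<ge>N. dist (form (X m) (Y m)) (form (X n) (Y n)) < e"
    by blast
qed

text \<open>Pairing with the point \<open>s\<close> is evaluation at \<open>s\<close>, as in a
  reproducing kernel Hilbert space. This turns formal combinations, and then elements of the
  completion, into functions.\<close>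

definition eval :: "(complex \<times> 'a) list \<Rightarrow> 'a \<Rightarrow> complex" where
  "eval c s = form c [(1, s)]"

lemma eval_simps [simp]:
  "eval [] s = 0" "eval (c @ d) s = eval c s + eval d s" "eval (lin_scale z c) s = z * eval c s"
  "eval (lin_diff c d) s = eval c s - eval d s"
  by (simp_all add: eval_def)

lemma tendsto_form_const:
  assumes "\<And>s. (\<lambda>n. eval (Z n) s) \<longlonglongrightarrow> 0"
  shows "(\<lambda>n. form (Z n) d) \<longlonglongrightarrow> 0"
proof (induction d)
  case (Cons p d)
  obtain b y where p: "p = (b, y)" by force
  have "form (Z n) [p] = cnj b * eval (Z n) y" for n
    using kernel_form_scale(2)[of k "Z n" b "[(1, y)]"] by (simp add: p eval_def lin_scale_def)
  then have "(\<lambda>n. form (Z n) (p # d)) = (\<lambda>n. cnj b * eval (Z n) y + form (Z n) d)"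
    by (subst kernel_form_Cons) simp
  then show ?case
    using tendsto_add[OF tendsto_mult_right_zero[OF assms[of y], of "cnj b"] Cons] by simp
qed simp

text \<open>The reason why the completion embeds into functions: the pointwise limit determines a
  Cauchy sequence up to a null sequence. For a fixed large \<open>N\<close> the squared seminorm of
  \<open>Z n\<close> splits into \<open>form (Z n) (Z N)\<close>, which tends to 0 by pointwise
  convergence, and \<open>form (Z n) (lin_diff (Z n) (Z N))\<close>, which is small by the Cauchy
  property and boundedness.\<close>

lemma seminorm_tendsto_0:
  assumes Z: "seminorm_Cauchy Z" and lim: "\<And>s. (\<lambda>n. eval (Z n) s) \<longlonglongrightarrow> 0"
  shows "(\<lambda>n. seminorm (Z n)) \<longlonglongrightarrow> 0"
proof -
  obtain M where M: "0 < M" "\<And>n. seminorm (Z n) \<le> M" using seminorm_Cauchy_bounded[OF Z] by blast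
  have "(\<lambda>n. (seminorm (Z n))\<^sup>2) \<longlonglongrightarrow> 0"
  proof (rule metric_LIMSEQ_I)
    fix e :: real assume "0 < e"
    then obtain N where N: "\<forall>m\<ge>N. \<forall>n\<ge>N. seminorm (lin_diff (Z m) (Z n)) < e / (2 * M)"
      using seminorm_CauchyD[OF Z, of "e / (2 * M)"] M by auto
    obtain N' where N': "\<forall>n\<ge>N'. cmod (form (Z n) (Z N)) < e / 2"
      using LIMSEQ_D[OF tendsto_form_const[OF lim, of "Z N"], of "e / 2"] \<open>0 < e\<close> by auto
    have "(seminorm (Z n))\<^sup>2 < e" if "n \<ge> max N N'" for n
    proof -
      have "(seminorm (Z n))\<^sup>2 = cmod (form (Z n) (Z n))"
        using form_self[of "Z n"] by (simp only: norm_of_real) simp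
      also have "\<dots> = cmod (form (Z n) (Z N) + form (Z n) (lin_diff (Z n) (Z N)))"
        by simp
      also have "\<dots> \<le> cmod (form (Z n) (Z N)) + seminorm (Z n) * seminorm (lin_diff (Z n) (Z N))"
        by (intro norm_triangle_mono form_Cauchy_Schwarz order_refl)
      also have "\<dots> \<le> cmod (form (Z n) (Z N)) + M * seminorm (lin_diff (Z n) (Z N))"
        using M(2) by (intro add_mono mult_right_mono) auto
      also have "\<dots> < e / 2 + M * (e / (2 * M))"
        using N N' that M(1) by (intro add_strict_mono mult_strict_left_mono) auto
      also have "\<dots> = e" using M(1) by (simp add: field_simps)
      finally show ?thesis .
    qed
    then show "\<exists>N. \<forall>n\<ge>N. dist ((seminorm (Z n))\<^sup>2) 0 < e"
      by (intro exI[of _ "max N N'"]) simp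
  qed
  then have "(\<lambda>n. sqrt ((seminorm (Z n))\<^sup>2)) \<longlonglongrightarrow> sqrt 0"
    by (rule tendsto_real_sqrt)
  then show ?thesis by simp
qed

text \<open>Elements of the completion are taken to be pointwise limits of Cauchy sequences instead
  of classes of such sequences, so that the Hilbert space is carried by a set of functions.\<close>

definition represents :: "(nat \<Rightarrow> (complex \<times> 'a) list) \<Rightarrow> ('a \<Rightarrow> complex) \<Rightarrow> bool" where
  "represents X F \<longleftrightarrow> seminorm_Cauchy X \<and> (\<forall>s. (\<lambda>n. eval (X n) s) \<longlonglongrightarrow> F s)"

lemma seminorm_Cauchy_append:
  assumes "seminorm_Cauchy X" "seminorm_Cauchy Y" shows "seminorm_Cauchy (\<lambda>n. X n @ Y n)"
  unfolding seminorm_Cauchy_def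
proof (intro allI impI)
  fix e :: real assume "0 < e"
  obtain N where N: "\<forall>m\<ge>N. \<forall>n\<ge>N. seminorm (lin_diff (X m) (X n)) < e / 2"
    using seminorm_CauchyD[OF assms(1), of "e / 2"] \<open>0 < e\<close> by auto
  obtain N' where N': "\<forall>m\<ge>N'. \<forall>n\<ge>N'. seminorm (lin_diff (Y m) (Y n)) < e / 2"
    using seminorm_CauchyD[OF assms(2), of "e / 2"] \<open>0 < e\<close> by auto
  have "seminorm (lin_diff (X m @ Y m) (X n @ Y n)) < e" if "m \<ge> max N N'" "n \<ge> max N N'" for m n
  proof -
    have "seminorm (lin_diff (X m @ Y m) (X n @ Y n)) = seminorm (lin_diff (X m) (X n) @ lin_diff (Y m) (Y n))"
      by (rule seminorm_cong) (simp add: algebra_simps)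
    also have "\<dots> \<le> seminorm (lin_diff (X m) (X n)) + seminorm (lin_diff (Y m) (Y n))"
      by (rule seminorm_append_le)
    also have "\<dots> < e / 2 + e / 2"
      using N N' that by (intro add_strict_mono) auto
    finally show ?thesis by simp
  qed
  then show "\<exists>N. \<forall>m\<ge>N. \<forall>n\<ge>N. seminorm (lin_diff (X m @ Y m) (X n @ Y n)) < e"
    by blast
qed

lemma seminorm_Cauchy_scale:
  assumes "seminorm_Cauchy X" shows "seminorm_Cauchy (\<lambda>n. lin_scale z (X n))"
  unfolding seminorm_Cauchy_def
proof (intro allI impI)
  fix e :: real assume "0 < e"
  then have "0 < e / (cmod z + 1)" by (simp add: add_nonneg_pos)
  then obtain N where N: "\<forall>m\<ge>N. \<forall>n\<ge>N. seminorm (lin_diff (X m) (X n)) < e / (cmod z + 1)"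
    using seminorm_CauchyD[OF assms] by blast
  have "seminorm (lin_diff (lin_scale z (X m)) (lin_scale z (X n))) < e" if "m \<ge> N" "n \<ge> N" for m n
  proof -
    have "seminorm (lin_diff (lin_scale z (X m)) (lin_scale z (X n))) = seminorm (lin_scale z (lin_diff (X m) (X n)))"
      by (rule seminorm_cong) (simp add: algebra_simps)
    also have "\<dots> \<le> (cmod z + 1) * seminorm (lin_diff (X m) (X n))"
      by (simp add: seminorm_scale mult_right_mono)
    also have "\<dots> < (cmod z + 1) * (e / (cmod z + 1))"
      using N that by (intro mult_strict_left_mono) (auto simp: add_nonneg_pos)
    also have "\<dots> = e" using norm_ge_zero[of z] by (simp add: add_nonneg_eq_0_iff)
    finally show ?thesis .
  qed
  then show "\<exists>N. \<forall>m\<ge>N. \<forall>n\<ge>N. seminorm (lin_diff (lin_scale z (X m)) (lin_scale z (X n))) < e"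
    by blast
qed

lemma represents_add:
  "represents X F \<Longrightarrow> represents Y G \<Longrightarrow> represents (\<lambda>n. X n @ Y n) (F + G)"
  by (auto simp: represents_def intro: seminorm_Cauchy_append tendsto_add)

lemma represents_scale:
  "represents X F \<Longrightarrow> represents (\<lambda>n. lin_scale z (X n)) (fun_scale z F)"
  by (auto simp: represents_def fun_scale_def intro: seminorm_Cauchy_scale tendsto_mult_left)

lemma represents_diff:
  assumes "represents X F" "represents Y G"
  shows "represents (\<lambda>n. lin_diff (X n) (Y n)) (F - G)"
proof -
  have "F - G = F + fun_scale (-1) G" by (simp add: fun_eq_iff fun_scale_def)
  then show ?thesis
    unfolding lin_diff_def using represents_add[OF assms(1) represents_scale[OF assms(2)], of "-1"]
    by (simp only:)
qed

lemma represents_const: "represents (\<lambda>_. c) (eval c)"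
proof -
  have "seminorm (lin_diff c c) = 0" by (simp add: seminorm_def)
  then show ?thesis by (simp add: represents_def seminorm_Cauchy_def)
qed

definition carrier :: "('a \<Rightarrow> complex) set" where
  "carrier = {F. \<exists>X. represents X F}"

definition inner :: "('a \<Rightarrow> complex) \<Rightarrow> ('a \<Rightarrow> complex) \<Rightarrow> complex" where
  "inner F G = lim (\<lambda>n. form ((SOME X. represents X F) n) ((SOME X. represents X G) n))"

lemma represents_diff_tendsto_0:
  assumes "represents X F" "represents Y F"
  shows "(\<lambda>n. seminorm (lin_diff (X n) (Y n))) \<longlonglongrightarrow> 0"
  using represents_diff[OF assms] by (intro seminorm_tendsto_0) (simp_all add: represents_def)

text \<open>Independence of the choice made by \<open>SOME\<close> in \<open>inner\<close>: two
  sequences representing the same function differ by a null sequence, and the form is continuous on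
  bounded sets.\<close>

lemma tendsto_inner:
  assumes X: "represents X F" and Y: "represents Y G"
  shows "(\<lambda>n. form (X n) (Y n)) \<longlonglongrightarrow> inner F G"
proof -
  define X' Y' where "X' = (SOME X. represents X F)" and "Y' = (SOME X. represents X G)"
  have X': "represents X' F" and Y': "represents Y' G"
    unfolding X'_def Y'_def using someI[of "\<lambda>X. represents X F", OF X] someI[of "\<lambda>X. represents X G", OF Y] by blast+
  have lim: "(\<lambda>n. form (X' n) (Y' n)) \<longlonglongrightarrow> inner F G"
  proof -
    have "convergent (\<lambda>n. form (X' n) (Y' n))"
      using X' Y' by (intro convergent_form) (simp_all add: represents_def)
    then show ?thesis
      unfolding inner_def X'_def[symmetric] Y'_def[symmetric] by (simp add: convergent_LIMSEQ_iff)
  qed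
  obtain M where M: "0 < M" "\<And>n. seminorm (X' n) \<le> M"
    using X' seminorm_Cauchy_bounded unfolding represents_def by blast
  obtain M' where M': "0 < M'" "\<And>n. seminorm (Y n) \<le> M'"
    using Y seminorm_Cauchy_bounded unfolding represents_def by blast
  have "(\<lambda>n. seminorm (lin_diff (X n) (X' n)) * M' + M * seminorm (lin_diff (Y n) (Y' n))) \<longlonglongrightarrow> 0 * M' + M * 0"
    by (intro tendsto_intros represents_diff_tendsto_0[OF X X'] represents_diff_tendsto_0[OF Y Y'])
  then have bound: "(\<lambda>n. seminorm (lin_diff (X n) (X' n)) * M' + M * seminorm (lin_diff (Y n) (Y' n))) \<longlonglongrightarrow> 0"
    by simp
  have "cmod (form (X n) (Y n) - form (X' n) (Y' n))
      \<le> seminorm (lin_diff (X n) (X' n)) * M' + M * seminorm (lin_diff (Y n) (Y' n))" for n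
  proof -
    have "seminorm (lin_diff (X n) (X' n)) * seminorm (Y n) + seminorm (X' n) * seminorm (lin_diff (Y n) (Y' n))
        \<le> seminorm (lin_diff (X n) (X' n)) * M' + M * seminorm (lin_diff (Y n) (Y' n))"
      using M(2) M'(2) by (intro add_mono mult_left_mono mult_right_mono) auto
    then show ?thesis using form_diff_le order_trans by blast
  qed
  then have "(\<lambda>n. form (X n) (Y n) - form (X' n) (Y' n)) \<longlonglongrightarrow> 0"
    by (intro Lim_null_comparison[OF _ bound] always_eventually allI)
  from tendsto_add[OF this lim] show ?thesis by simp
qed

lemma tendsto_inner_norm:
  assumes "represents X F"
  shows "(\<lambda>n. seminorm (X n)) \<longlonglongrightarrow> inner_norm inner F"
  unfolding inner_norm_def seminorm_def
  by (intro tendsto_real_sqrt tendsto_Re tendsto_inner assms)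

lemma carrierI: "represents X F \<Longrightarrow> F \<in> carrier"
  by (auto simp: carrier_def)

lemma carrierE: "F \<in> carrier \<Longrightarrow> (\<And>X. represents X F \<Longrightarrow> thesis) \<Longrightarrow> thesis"
  by (auto simp: carrier_def)

lemma complex_inner_space_carrier: "complex_inner_space fun_scale carrier inner"
proof -
  interpret vector_space "fun_scale :: complex \<Rightarrow> ('a \<Rightarrow> complex) \<Rightarrow> _"
    by (rule vector_space_fun_scale)
  show "complex_inner_space fun_scale carrier inner"
  proof unfold_locales
    show "subspace carrier"
    proof (rule subspaceI)
      show "0 \<in> carrier"
        using represents_const[of "[]"] by (auto intro!: carrierI simp: fun_eq_iff zero_fun_def cong: represents_def)
    qed (auto elim!: carrierE intro: carrierI represents_add represents_scale)
  next
    fix F G E assume "F \<in> carrier" "G \<in> carrier" "E \<in> carrier"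
    then obtain X Y Z where "represents X F" "represents Y G" "represents Z E"
      by (meson carrierE)
    then show "inner (F + G) E = inner F E + inner G E"
      using tendsto_add[OF tendsto_inner tendsto_inner] tendsto_inner[OF represents_add]
      by (intro LIMSEQ_unique[of "\<lambda>n. form (X n @ Y n) (Z n)"]) auto
  next
    fix c F G assume "F \<in> carrier" "G \<in> carrier"
    then obtain X Y where "represents X F" "represents Y G"
      by (meson carrierE)
    then show "inner (fun_scale c F) G = c * inner F G"
      using tendsto_mult_left[OF tendsto_inner] tendsto_inner[OF represents_scale]
      by (intro LIMSEQ_unique[of "\<lambda>n. form (lin_scale c (X n)) (Y n)"]) auto
  next
    fix F G assume "F \<in> carrier" "G \<in> carrier"
    then obtain X Y where X: "represents X F" and Y: "represents Y G"
      by (meson carrierE)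
    have "(\<lambda>n. form (Y n) (X n)) \<longlonglongrightarrow> cnj (inner F G)"
      using tendsto_cnj[OF tendsto_inner[OF X Y]] by (simp only: form_herm[of "Y _" "X _", symmetric])
    then show "inner G F = cnj (inner F G)"
      using tendsto_inner[OF Y X] LIMSEQ_unique by blast
  next
    fix F assume "F \<in> carrier" and F: "F \<noteq> 0"
    then obtain X where X: "represents X F" by (meson carrierE)
    have lim: "(\<lambda>n. (seminorm (X n))\<^sup>2) \<longlonglongrightarrow> Re (inner F F)"
      using tendsto_Re[OF tendsto_inner[OF X X]] by (simp add: seminorm_sq)
    then have "0 \<le> Re (inner F F)" by (rule LIMSEQ_le_const) simp
    moreover have "Re (inner F F) \<noteq> 0"
    proof
      assume "Re (inner F F) = 0"
      then have sn0: "(\<lambda>n. seminorm (X n)) \<longlonglongrightarrow> 0"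
        using tendsto_real_sqrt[OF lim] by simp
      \<comment> \<open>Evaluation at \<open>s\<close> is bounded by the seminorm, so an element of
        norm zero vanishes pointwise.\<close>
      have "F s = 0" for s
      proof -
        have "(\<lambda>n. eval (X n) s) \<longlonglongrightarrow> 0"
        proof (rule Lim_null_comparison[OF always_eventually])
          show "\<forall>n. cmod (eval (X n) s) \<le> seminorm (X n) * seminorm [(1, s)]"
            unfolding eval_def using form_Cauchy_Schwarz by blast
          show "(\<lambda>n. seminorm (X n) * seminorm [(1, s)]) \<longlonglongrightarrow> 0"
            by (rule tendsto_mult_left_zero[OF sn0])
        qed
        then show ?thesis using X LIMSEQ_unique unfolding represents_def by blast
      qed
      then show False using F by (auto simp: fun_eq_iff)
    qed
    ultimately show "0 < Re (inner F F)" by simp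
  qed
qed

lemma inner_norm_eval: "inner_norm inner (eval c) = seminorm c"
  using tendsto_inner_norm[OF represents_const[of c]] by (simp add: LIMSEQ_const_iff)

lemma eval_in_carrier [simp]: "eval c \<in> carrier"
  by (rule carrierI[OF represents_const])

lemma eval_diff: "eval c - eval d = eval (lin_diff c d)"
  by (simp add: fun_eq_iff)

text \<open>Finite combinations are dense: for fixed \<open>m\<close> the distance from
  \<open>eval (X m)\<close> to \<open>F\<close> is the limit over \<open>n\<close> of the seminorms
  of \<open>lin_diff (X m) (X n)\<close>.\<close>

lemma eval_tendsto:
  assumes X: "represents X F"
  shows "(\<lambda>n. inner_norm inner (eval (X n) - F)) \<longlonglongrightarrow> 0"
proof (rule metric_LIMSEQ_I)
  interpret complex_inner_space fun_scale carrier inner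
    by (rule complex_inner_space_carrier)
  fix e :: real assume "0 < e"
  then obtain N where N: "\<forall>m\<ge>N. \<forall>n\<ge>N. seminorm (lin_diff (X m) (X n)) < e / 2"
    using X seminorm_CauchyD[of X "e / 2"] by (auto simp: represents_def)
  have "inner_norm inner (eval (X m) - F) \<le> e / 2" if "m \<ge> N" for m
  proof (rule LIMSEQ_le_const2)
    show "(\<lambda>n. seminorm (lin_diff (X m) (X n))) \<longlonglongrightarrow> inner_norm inner (eval (X m) - F)"
      by (rule tendsto_inner_norm[OF represents_diff[OF represents_const X]])
    show "\<exists>N. \<forall>n\<ge>N. seminorm (lin_diff (X m) (X n)) \<le> e / 2"
      using N that by (intro exI[of _ N]) (auto intro: less_imp_le)
  qed
  then show "\<exists>N. \<forall>n\<ge>N. dist (inner_norm inner (eval (X n) - F)) 0 < e"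
    using \<open>0 < e\<close> carrierI[OF X] by (intro exI[of _ N]) (fastforce simp: dist_real_def)
qed

text \<open>The \<open>n\<close>-th element is replaced by a finite combination at distance below
  \<open>1 / Suc n\<close>. These combinations form a Cauchy sequence, and the function that it
  represents is the limit.\<close>

lemma complex_hilbert_space_carrier: "complex_hilbert_space fun_scale carrier inner"
proof -
  interpret complex_inner_space fun_scale carrier inner
    by (rule complex_inner_space_carrier)
  show ?thesis
  proof unfold_locales
    let ?N = "inner_norm inner"
    fix X :: "nat \<Rightarrow> 'a \<Rightarrow> complex" assume X: "\<And>n. X n \<in> carrier"
      and Cauchy: "\<forall>e>0. \<exists>N. \<forall>m\<ge>N. \<forall>n\<ge>N. ?N (X m - X n) < e"
    have "\<exists>c. ?N (X n - eval c) < 1 / real (Suc n)" for n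
    proof -
      obtain Y where Y: "represents Y (X n)" using X carrierE by blast
      have "0 < 1 / real (Suc n)" by simp
      from LIMSEQ_D[OF eval_tendsto[OF Y] this]
      obtain m where "?N (eval (Y m) - X n) < 1 / real (Suc n)"
        by (metis abs_less_iff diff_zero order_refl real_norm_def)
      then have "?N (X n - eval (Y m)) < 1 / real (Suc n)"
        using X inner_norm_minus_commute[of "X n" "eval (Y m)"] by simp
      then show ?thesis by blast
    qed
    then obtain c where c: "\<And>n. ?N (X n - eval (c n)) < 1 / real (Suc n)" by metis
    have Cc: "seminorm_Cauchy c"
      unfolding seminorm_Cauchy_def
    proof (intro allI impI)
      fix e :: real assume "0 < e"
      then obtain N where N: "\<forall>m\<ge>N. \<forall>n\<ge>N. ?N (X m - X n) < e / 3"
        using Cauchy[rule_format, of "e / 3"] by auto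
      obtain N' where N': "1 / real (Suc N') < e / 3"
        using reals_Archimedean[of "e / 3"] \<open>0 < e\<close> by (auto simp: inverse_eq_divide)
      have "seminorm (lin_diff (c m) (c n)) < e" if "m \<ge> max N N'" "n \<ge> max N N'" for m n
      proof -
        have small: "?N (X l - eval (c l)) < e / 3" if "l \<ge> N'" for l
        proof -
          have "1 / real (Suc l) \<le> 1 / real (Suc N')" using that by (simp add: field_simps)
          then show ?thesis using c[of l] N' by linarith
        qed
        have "seminorm (lin_diff (c m) (c n)) = ?N (eval (c m) - eval (c n))"
          by (simp only: eval_diff inner_norm_eval)
        also have "\<dots> \<le> ?N (eval (c m) - X m) + (?N (X m - X n) + ?N (X n - eval (c n)))"
          using inner_norm_triangle3[of "eval (c m)" "X m" "eval (c n)"]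
            inner_norm_triangle3[of "X m" "X n" "eval (c n)"] X by simp
        also have "\<dots> < e / 3 + (e / 3 + e / 3)"
          using small[of m] small[of n] N that inner_norm_minus_commute[of "X m" "eval (c m)"] X
          by (intro add_strict_mono) auto
        finally show ?thesis by simp
      qed
      then show "\<exists>N. \<forall>m\<ge>N. \<forall>n\<ge>N. seminorm (lin_diff (c m) (c n)) < e" by blast
    qed
    have "convergent (\<lambda>n. eval (c n) s)" for s
    proof -
      have "seminorm_Cauchy (\<lambda>_. [(1, s)])" using represents_const by (simp add: represents_def)
      from convergent_form[OF Cc this] show ?thesis by (simp add: eval_def)
    qed
    then have rep: "represents c (\<lambda>s. lim (\<lambda>n. eval (c n) s))" (is "represents c ?L")
      using Cc by (simp add: represents_def convergent_LIMSEQ_iff)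
    have L: "?L \<in> carrier" by (rule carrierI[OF rep])
    have "(\<lambda>n. ?N (X n - ?L)) \<longlonglongrightarrow> 0"
    proof (rule Lim_null_comparison[OF always_eventually])
      show "\<forall>n. norm (?N (X n - ?L)) \<le> 1 / real (Suc n) + ?N (eval (c n) - ?L)"
      proof
        fix n
        show "norm (?N (X n - ?L)) \<le> 1 / real (Suc n) + ?N (eval (c n) - ?L)"
          using inner_norm_triangle3[of "X n" "eval (c n)" ?L] c[of n] X L inner_norm_nonneg[of "X n - ?L"]
          by simp
      qed
      show "(\<lambda>n. 1 / real (Suc n) + ?N (eval (c n) - ?L)) \<longlonglongrightarrow> 0"
        using tendsto_add[OF LIMSEQ_Suc[OF lim_1_over_n] eval_tendsto[OF rep]] by simp
    qed
    then show "\<exists>l\<in>carrier. (\<lambda>n. ?N (X n - l)) \<longlonglongrightarrow> 0" using L by blast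
  qed (fact subspace_H ip_add_left ip_scale_left ip_cnj ip_pos)+
qed

end

text \<open>The Gelfand-Naimark-Segal construction: a continuous positive definite function \<open>\<phi>\<close> is a
  diagonal coefficient of translation on the space of the kernel \<open>\<phi>(-y + x)\<close>.\<close>

lemma P1_if_psd_kernel:
  fixes \<phi> :: "'a::topological_group_add \<Rightarrow> complex"
  assumes psd: "psd_kernel (\<lambda>x y. \<phi> (- y + x))" and cont: "continuous_on UNIV \<phi>" and "\<phi> 0 = 1"
  shows "\<phi> \<in> P1 TYPE('a \<Rightarrow> complex)"
proof -
  interpret psd_kernel_space "\<lambda>x y. \<phi> (- y + x)"
    by unfold_locales (rule psd)
  interpret complex_hilbert_space fun_scale carrier inner
    by (rule complex_hilbert_space_carrier)
  define shift where "shift r c = map (\<lambda>(a, x). (a, r + x)) c" for r :: 'a and c :: "(complex \<times> 'a) list"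
  define \<pi> where "\<pi> r F = (\<lambda>s. F (- r + s))" for r :: 'a and F :: "'a \<Rightarrow> complex"
  \<comment> \<open>The first identity is invariance of the kernel under left translation, the
    second matches translation of points with translation of functions, and the third makes \<pi>
    multiplicative.\<close>
  have cancel: "- (r + y) + (r + x) = - y + x" "- s + (r + x) = - (- r + s) + x"
    "- (r + s) + x = - s + (- r + x)" for r s x y :: 'a
    by (simp_all add: minus_add add.assoc del: add_uminus_conv_diff)
  have form_shift: "form (shift r c) (shift r d) = form c d" for r c d
    by (simp add: shift_def kernel_form_def split_def o_def cancel(1) del: minus_add)
  have diff_shift: "seminorm (lin_diff (shift r c) (shift r d)) = seminorm (lin_diff c d)" for r c d
    by (rule seminorm_cong) (simp add: form_shift)
  have eval_shift: "eval (shift r c) = \<pi> r (eval c)" for r c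
    by (simp add: fun_eq_iff \<pi>_def eval_def shift_def kernel_form_def split_def o_def cancel(2) del: minus_add)
  have rep_shift: "represents (\<lambda>n. shift r (X n)) (\<pi> r F)" if "represents X F" for r X F
    using that unfolding represents_def seminorm_Cauchy_def diff_shift eval_shift by (simp add: \<pi>_def)
  have \<pi>_carrier: "\<pi> r F \<in> carrier" if "F \<in> carrier" for r F
    using that rep_shift unfolding carrier_def by blast
  have \<pi>_inner: "inner (\<pi> r F) (\<pi> r G) = inner F G" if FG: "F \<in> carrier" "G \<in> carrier" for r F G
  proof -
    obtain X Y where X: "represents X F" and Y: "represents Y G"
      using FG unfolding carrier_def by blast
    show ?thesis
      using tendsto_inner[OF rep_shift[OF X] rep_shift[OF Y], of r r] tendsto_inner[OF X Y]
      unfolding form_shift by (rule LIMSEQ_unique)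
  qed
  have \<pi>_diff: "\<pi> r F - \<pi> r G = \<pi> r (F - G)" for r F G
    by (simp add: \<pi>_def fun_eq_iff)
  have \<pi>_norm: "inner_norm inner (\<pi> r F) = inner_norm inner F" if "F \<in> carrier" for r F
    using \<pi>_inner[OF that that] by (simp add: inner_norm_def)
  have form_cont: "((\<lambda>r. form (shift r c) d) \<longlongrightarrow> form (shift s c) d) (at s)" for s c d
    unfolding kernel_form_conv_sum shift_def length_map
    by (intro tendsto_sum tendsto_mult tendsto_const) (auto simp: split_def
      intro!: continuous_on_tendsto_compose[OF cont] tendsto_intros)
  \<comment> \<open>Translations are isometric, so the squared distance is twice
    \<open>form c c\<close> minus twice the real part of a cross term. Strong continuity is thereby
    reduced to continuity of \<phi>.\<close>
  have seminorm_cont: "((\<lambda>r. seminorm (lin_diff (shift r c) (shift s c))) \<longlongrightarrow> 0) (at s)" for s c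
  proof -
    have "((\<lambda>r. form (shift r c) (shift s c)) \<longlongrightarrow> form c c) (at s)"
      using form_cont[of c "shift s c" s] by (simp only: form_shift)
    then have "((\<lambda>r. sqrt (2 * Re (form c c) - 2 * Re (form (shift r c) (shift s c)))) \<longlongrightarrow>
        sqrt (2 * Re (form c c) - 2 * Re (form c c))) (at s)"
      by (intro tendsto_intros)
    moreover have "seminorm (lin_diff (shift r c) (shift s c))
        = sqrt (2 * Re (form c c) - 2 * Re (form (shift r c) (shift s c)))" for r
      using form_herm[of "shift s c" "shift r c"] by (simp add: seminorm_def form_shift)
    ultimately show ?thesis by simp
  qed
  have "unitary_rep fun_scale carrier inner \<pi>"
  proof unfold_locales
    fix r :: 'a
    have inv: "\<pi> r (\<pi> (- r) F) = F" "\<pi> (- r) (\<pi> r F) = F" for F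
      by (simp_all add: \<pi>_def add.assoc[symmetric])
    show "bij_betw (\<pi> r) carrier carrier"
      by (rule bij_betwI[where g = "\<pi> (- r)"]) (auto simp: inv \<pi>_carrier)
  next
    fix F s assume "F \<in> carrier"
    then obtain X where X: "represents X F" unfolding carrier_def by blast
    show "((\<lambda>r. inner_norm inner (\<pi> r F - \<pi> s F)) \<longlongrightarrow> 0) (at s)"
    proof (rule tendstoI)
      fix e :: real assume "0 < e"
      \<comment> \<open>Isometry makes the approximation of \<open>F\<close> by a finite combination
        uniform over all translates, which allows an \<open>e / 3\<close> argument.\<close>
      then obtain n where n: "inner_norm inner (eval (X n) - F) < e / 3"
        using order_tendstoD(2)[OF eval_tendsto[OF X], of "e / 3"]
        by (auto dest: eventually_happens)
      have "\<forall>\<^sub>F r in at s. seminorm (lin_diff (shift r (X n)) (shift s (X n))) < e / 3"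
        using order_tendstoD(2)[OF seminorm_cont, of "e / 3"] \<open>0 < e\<close> by simp
      then show "\<forall>\<^sub>F r in at s. dist (inner_norm inner (\<pi> r F - \<pi> s F)) 0 < e"
      proof eventually_elim
        case (elim r)
        have near: "inner_norm inner (\<pi> q (eval (X n)) - \<pi> q F) < e / 3" for q
          using n \<open>F \<in> carrier\<close> by (simp add: \<pi>_diff \<pi>_norm)
        have "inner_norm inner (\<pi> r F - \<pi> s F) \<le> inner_norm inner (\<pi> r F - \<pi> r (eval (X n)))
            + (inner_norm inner (\<pi> r (eval (X n)) - \<pi> s (eval (X n)))
            + inner_norm inner (\<pi> s (eval (X n)) - \<pi> s F))"
          using inner_norm_triangle3[of "\<pi> r F" "\<pi> r (eval (X n))" "\<pi> s F"]
            inner_norm_triangle3[of "\<pi> r (eval (X n))" "\<pi> s (eval (X n))" "\<pi> s F"]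
            \<open>F \<in> carrier\<close> by (simp add: \<pi>_carrier)
        also have "inner_norm inner (\<pi> r F - \<pi> r (eval (X n))) = inner_norm inner (\<pi> r (eval (X n)) - \<pi> r F)"
          using \<open>F \<in> carrier\<close> by (intro inner_norm_minus_commute) (simp_all add: \<pi>_carrier)
        also have "inner_norm inner (\<pi> r (eval (X n)) - \<pi> s (eval (X n))) < e / 3"
          using elim by (simp only: eval_shift[symmetric] eval_diff inner_norm_eval)
        finally have "inner_norm inner (\<pi> r F - \<pi> s F) < e"
          using near[of r] near[of s] by linarith
        then show ?case
          using \<open>F \<in> carrier\<close> by (simp add: dist_real_def \<pi>_carrier)
      qed
    qed
  qed (auto simp: \<pi>_def fun_scale_def fun_eq_iff \<pi>_inner[unfolded \<pi>_def] cancel(3) simp del: minus_add)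
  \<comment> \<open>The unit vector is the function of the point mass at the identity.\<close>
  moreover have "inner_norm inner (eval [(1, 0)]) = 1"
    using \<open>\<phi> 0 = 1\<close> by (simp add: inner_norm_eval seminorm_def kernel_form_def)
  moreover have "\<phi> = (\<lambda>r. inner (\<pi> r (eval [(1, 0)])) (eval [(1, 0)]))"
  proof
    fix r
    have "(\<lambda>_::nat. form (shift r [(1, 0)]) [(1, 0)]) \<longlonglongrightarrow> inner (\<pi> r (eval [(1, 0)])) (eval [(1, 0)])"
      unfolding eval_shift[symmetric] by (rule tendsto_inner[OF represents_const represents_const])
    then show "\<phi> r = inner (\<pi> r (eval [(1, 0)])) (eval [(1, 0)])"
      by (simp add: LIMSEQ_const_iff shift_def kernel_form_def)
  qed
  ultimately show ?thesis
    unfolding P1_def using eval_in_carrier by blast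
qed

section \<open>Positive definite functions of norm one\<close>

text \<open>\<open>P1_mult\<close> is the equality case of Cauchy-Schwarz: modulus 1 makes the unit
  vector \<xi> an eigenvector of \<open>\<pi> r\<close> with eigenvalue \<open>\<rho> r\<close>.
  \<open>P1_psd_kernel\<close> holds because the kernel is the Gram kernel of the orbit of
  \<xi>.\<close>

lemma P1_D:
  fixes \<rho> :: "'a::topological_group_add \<Rightarrow> complex"
  assumes "\<rho> \<in> P1 TYPE('h::ab_group_add)"
  shows P1_continuous: "continuous_on UNIV \<rho>"
    and P1_zero: "\<rho> 0 = 1"
    and P1_le: "cmod (\<rho> r) \<le> 1"
    and P1_minus: "\<rho> (- r) = cnj (\<rho> r)"
    and P1_mult: "cmod (\<rho> r) = 1 \<Longrightarrow> \<rho> (r + s) = \<rho> r * \<rho> s"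
    and P1_psd_kernel: "psd_kernel (\<lambda>x y. \<rho> (- y + x))"
proof -
  obtain scale and H :: "'h set" and ip \<pi> \<xi> where
    rep: "unitary_rep scale H ip \<pi>" and \<xi>: "\<xi> \<in> H" "inner_norm ip \<xi> = 1"
    and \<rho>: "\<rho> = (\<lambda>r. ip (\<pi> r \<xi>) \<xi>)"
    using assms unfolding P1_def by blast
  interpret unitary_rep scale H ip \<pi> by (fact rep)
  show "continuous_on UNIV \<rho>"
    unfolding \<rho> by (intro continuous_on_coefficient \<xi>)
  show "\<rho> 0 = 1" using \<xi> ip_self[of \<xi>] by (simp add: \<rho>)
  show "cmod (\<rho> r) \<le> 1" for r
    using cmod_coefficient_le[of \<xi> \<xi> r] \<xi> by (simp add: \<rho>)
  show minus: "\<rho> (- r) = cnj (\<rho> r)" for r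
    using rep_ip_left[of \<xi> \<xi> "- r"] ip_cnj[of "\<pi> r \<xi>" \<xi>] \<xi> by (simp add: \<rho>)
  have eigen: "\<pi> r \<xi> = scale (\<rho> r) \<xi>" if "cmod (\<rho> r) = 1" for r
  proof -
    have "\<rho> r * cnj (\<rho> r) = 1"
      using that complex_norm_square[of "\<rho> r"] by simp
    then have "Re (ip (\<pi> r \<xi>) (scale (\<rho> r) \<xi>)) = 1"
      using \<xi> by (simp only: ip_scale_right rep_in_H \<rho>[THEN fun_cong, of r, symmetric] mult.commute) simp
    then have "(inner_norm ip (\<pi> r \<xi> - scale (\<rho> r) \<xi>))\<^sup>2 = 0"
      using \<xi> that by (simp add: inner_norm_diff_sq inner_norm_scale)
    then show ?thesis
      using inner_norm_eq_0[of "\<pi> r \<xi> - scale (\<rho> r) \<xi>"] \<xi> by simp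
  qed
  show "\<rho> (r + s) = \<rho> r * \<rho> s" if "cmod (\<rho> r) = 1" for r s
  proof -
    have "\<rho> (r + s) = ip (\<pi> s \<xi>) (\<pi> (- r) \<xi>)"
      using \<xi> rep_ip_left[of "\<pi> s \<xi>" \<xi> r] by (simp add: \<rho> rep_mult)
    also have "\<pi> (- r) \<xi> = scale (cnj (\<rho> r)) \<xi>"
      using eigen[of "- r"] that minus[of r] by simp
    also have "ip (\<pi> s \<xi>) (scale (cnj (\<rho> r)) \<xi>) = \<rho> r * \<rho> s"
      using \<xi> by (simp add: ip_scale_right \<rho>)
    finally show ?thesis .
  qed
  \<comment> \<open>\<open>V\<close> sends a formal combination of group elements to the same
    combination of the vectors \<open>\<pi> x \<xi>\<close>, so that \<open>kernel_form\<close>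
    becomes an inner product.\<close>
  define V where "V = rec_list 0 (\<lambda>(a, x) _ v. scale a (\<pi> x \<xi>) + v)"
  have V [simp]: "V [] = 0" "V ((a, x) # c) = scale a (\<pi> x \<xi>) + V c" for a x c
    by (simp_all add: V_def)
  have V_H [simp]: "V c \<in> H" for c
    using \<xi> by (induction c) auto
  have k: "\<rho> (- y + x) = ip (\<pi> x \<xi>) (\<pi> y \<xi>)" for x y
    using \<xi> rep_ip_left[of "\<pi> x \<xi>" \<xi> "- y"] by (simp add: \<rho> rep_mult)
  have "kernel_form (\<lambda>x y. \<rho> (- y + x)) c d = ip (V c) (V d)" for c d
  proof (induction c)
    case (Cons p c)
    obtain a x where p: "p = (a, x)" by force
    have "kernel_form (\<lambda>x y. \<rho> (- y + x)) [(a, x)] d = ip (scale a (\<pi> x \<xi>)) (V d)"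
    proof (induction d)
      case (Cons q d)
      then show ?case
        using \<xi> kernel_form_Cons(2)[of "\<lambda>x y. \<rho> (- y + x)" "[(a, x)]" q d]
        by (cases q) (simp add: kernel_form_def k ip_simps algebra_simps)
    qed (use \<xi> in simp)
    with Cons show ?case
      using \<xi> kernel_form_Cons(1)[of "\<lambda>x y. \<rho> (- y + x)" p c d] by (simp add: p ip_add_left)
  qed simp
  note form = this
  have "\<rho> (- x + y) = cnj (\<rho> (- y + x))" for x y
    using \<xi> unfolding k by (intro ip_cnj) simp_all
  moreover have "0 \<le> Re (kernel_form (\<lambda>x y. \<rho> (- y + x)) c c)" for c
    unfolding form by (rule ip_self_nonneg) simp
  ultimately show "psd_kernel (\<lambda>x y. \<rho> (- y + x))"
    unfolding psd_kernel_def by blast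
qed

section \<open>Chords of the unit circle and oscillation near the identity\<close>

lemma cmod_cis_minus_1_sq: "(cmod (cis t - 1))\<^sup>2 = 2 - 2 * cos t"
proof -
  have "(cmod (cis t - 1))\<^sup>2 = (cos t - 1)\<^sup>2 + (sin t)\<^sup>2" by (simp add: cmod_power2)
  also have "\<dots> = 2 - 2 * cos t" using sin_cos_squared_add[of t] by (simp add: power2_diff)
  finally show ?thesis .
qed

lemma cmod_cis_minus_1_le: "cmod (cis t - 1) \<le> \<bar>t\<bar>"
proof -
  have "(cmod (cis t - 1))\<^sup>2 = (2 * sin (t / 2))\<^sup>2"
    using cos_double_sin[of "t / 2"] by (simp add: cmod_cis_minus_1_sq power_mult_distrib)
  also have "\<dots> \<le> \<bar>t\<bar>\<^sup>2"
    using abs_sin_x_le_abs_x[of "t / 2"] unfolding abs_le_square_iff[symmetric] by simp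
  finally show ?thesis by (rule power2_le_imp_le) simp
qed

text \<open>At the angle \<open>pi / 3\<close> the chord from 1 has length exactly 1, and it grows
  up to the angle \<open>pi\<close>.\<close>

lemma cmod_cis_minus_1_ge:
  assumes "pi / 3 \<le> \<bar>t\<bar>" "\<bar>t\<bar> \<le> pi" shows "1 \<le> cmod (cis t - 1)"
proof -
  have "cos t = cos \<bar>t\<bar>" by simp
  also have "\<dots> \<le> cos (pi / 3)" using assms by (intro cos_monotone_0_pi_le) auto
  finally have "1\<^sup>2 \<le> (cmod (cis t - 1))\<^sup>2" by (simp add: cmod_cis_minus_1_sq cos_60)
  then show ?thesis by (rule power2_le_imp_le) simp
qed

lemma ex_open_add_subset:
  fixes U :: "'a::topological_monoid_add set"
  assumes "open U" "0 \<in> U"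
  obtains W where "open W" "0 \<in> W" "\<And>x y. x \<in> W \<Longrightarrow> y \<in> W \<Longrightarrow> x + y \<in> U"
proof -
  have "((\<lambda>p::'a \<times> 'a. fst p + snd p) \<longlongrightarrow> 0 + 0) (nhds 0 \<times>\<^sub>F nhds 0)"
    by (rule tendsto_add_Pair)
  then have "\<forall>\<^sub>F p in nhds 0 \<times>\<^sub>F nhds (0::'a). fst p + snd p \<in> U"
    using assms by (auto simp: tendsto_def)
  then obtain P Q where P: "\<forall>\<^sub>F x in nhds 0. P x" and Q: "\<forall>\<^sub>F x in nhds 0. Q x"
    and PQ: "\<And>x y. P x \<Longrightarrow> Q y \<Longrightarrow> x + y \<in> U"
    unfolding eventually_prod_filter by auto
  obtain A B where "open A" "0 \<in> A" "\<forall>x\<in>A. P x" "open B" "0 \<in> B" "\<forall>x\<in>B. Q x"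
    using P Q unfolding eventually_nhds by blast
  then show ?thesis using PQ by (intro that[of "A \<inter> B"]) auto
qed

text \<open>The convergence argument on the group uses \<rho> only through these properties, with
  the representation left behind.\<close>

locale adapted_function =
  fixes \<rho> :: "'a::{topological_group_add,t2_space} \<Rightarrow> complex"
  assumes cont: "continuous_on UNIV \<rho>"
    and zero: "\<rho> 0 = 1"
    and le_1: "cmod (\<rho> r) \<le> 1"
    and minus: "\<rho> (- r) = cnj (\<rho> r)"
    and mult: "cmod (\<rho> r) = 1 \<Longrightarrow> \<rho> (r + s) = \<rho> r * \<rho> s"
    and eq_1: "\<rho> r = 1 \<Longrightarrow> r = 0"
begin

lemma tendsto_at_0: "(\<rho> \<longlongrightarrow> 1) (nhds 0)"
  using cont zero by (metis UNIV_I continuous_on_def tendsto_at_iff_tendsto_nhds at_within_open open_UNIV)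

text \<open>Where \<open>\<bar>\<rho>\<bar> = 1\<close> on a neighbourhood of \<open>0\<close>, the powers of \<open>\<rho>\<close> oscillate arbitrarily close to
  \<open>0\<close>: take \<open>s \<noteq> 0\<close> with \<open>\<rho> s = cis \<theta>\<close> and \<open>n\<theta>\<close> small, and the first multiple \<open>j s\<close> with
  \<open>j n \<bar>\<theta>\<bar> \<ge> pi / 3\<close>. The earlier multiples stay near \<open>0\<close>, because by compactness \<open>\<rho>\<close> is bounded
  away from \<open>1\<close> outside any neighbourhood of \<open>0\<close> in a compact set, while \<open>\<rho> (i s) = cis (i \<theta>)\<close> is
  within \<open>pi / (3 n)\<close> of \<open>1\<close>.\<close>

lemma ex_power_far_from_1:
  assumes lc: "locally_compact_space (euclidean :: 'a topology)"
    and nondiscrete: "\<not> open {0 :: 'a}"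
    and M: "open M" "0 \<in> M" "\<And>r. r \<in> M \<Longrightarrow> cmod (\<rho> r) = 1"
  shows "\<exists>n0. \<forall>n\<ge>n0. \<exists>s\<in>M. 1 \<le> cmod (\<rho> s ^ n - 1)"
proof -
  obtain O' K where O': "open O'" "0 \<in> O'" "O' \<subseteq> K" and K: "compact (K :: 'a set)"
    using lc unfolding locally_compact_space_def by (auto elim!: allE[of _ 0])
  \<comment> \<open>One more step in \<open>W\<close> from a point of \<open>W\<close> still ends
    where \<rho> has modulus 1 and where the compactness bound is available.\<close>
  obtain W where W: "open W" "0 \<in> W" and WW: "\<And>x y. x \<in> W \<Longrightarrow> y \<in> W \<Longrightarrow> x + y \<in> M \<inter> O'"
    using ex_open_add_subset[of "M \<inter> O'"] M O' by blast
  have WM: "x \<in> M" if "x \<in> W" for x using WW[OF W(2) that] by simp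
  have "\<exists>c>0. \<forall>x\<in>K - W. c \<le> cmod (\<rho> x - 1)"
  proof (cases "K - W = {}")
    case False
    have "compact (K - W)" using K W(1) by (rule compact_diff)
    moreover have "continuous_on (K - W) (\<lambda>x. cmod (\<rho> x - 1))"
      using cont by (intro continuous_intros) (auto intro: continuous_on_subset)
    ultimately obtain x where "x \<in> K - W" and x: "\<forall>y\<in>K - W. cmod (\<rho> x - 1) \<le> cmod (\<rho> y - 1)"
      using continuous_attains_inf[of "K - W"] False by blast
    moreover have "\<rho> x \<noteq> 1" using eq_1[of x] \<open>x \<in> K - W\<close> W(2) by auto
    ultimately show ?thesis by (intro exI[of _ "cmod (\<rho> x - 1)"]) auto
  qed (auto intro: exI[of _ 1])
  then obtain c where "0 < c" and c: "\<And>x. x \<in> K \<Longrightarrow> x \<notin> W \<Longrightarrow> c \<le> cmod (\<rho> x - 1)"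
    by auto
  \<comment> \<open>From \<open>n0\<close> on, \<open>pi / (3 * n) < c\<close>: angles this small
    are excluded on \<open>K\<close> outside \<open>W\<close>.\<close>
  obtain n0 where n0: "pi / (3 * c) < real n0" using reals_Archimedean2 by blast
  have "\<exists>s\<in>M. 1 \<le> cmod (\<rho> s ^ n - 1)" if "n \<ge> n0" for n
  proof -
    have "0 < pi / (3 * c)" using \<open>0 < c\<close> by simp
    then have n: "pi / (3 * c) < real n" "0 < real n" using n0 that by linarith+
    have "((\<lambda>r. Arg (\<rho> r)) \<longlongrightarrow> Arg 1) (nhds 0)"
      by (rule continuous_within_tendsto_compose'[of 1 UNIV Arg, OF _ _ tendsto_at_0])
        (auto intro!: continuous_at_Arg)
    then have "\<forall>\<^sub>F r in nhds 0. \<bar>Arg (\<rho> r)\<bar> < pi / (3 * real n)"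
      using n tendstoD[of "\<lambda>r. Arg (\<rho> r)" 0 _ "pi / (3 * real n)"] by (simp add: dist_real_def)
    then obtain B where B: "open B" "0 \<in> B" "\<forall>r\<in>B. \<bar>Arg (\<rho> r)\<bar> < pi / (3 * real n)"
      unfolding eventually_nhds by blast
    have "open (W \<inter> B)" using W(1) B(1) by (rule open_Int)
    then have "W \<inter> B \<noteq> {0}" using nondiscrete by metis
    then obtain s where s: "s \<in> W" "s \<in> B" "s \<noteq> 0" using W(2) B(2) by blast
    define \<theta> where "\<theta> = Arg (\<rho> s)"
    have s1: "cmod (\<rho> s) = 1" using M(3) WM s(1) by blast
    then have \<rho>s: "\<rho> s = cis \<theta>"
      unfolding \<theta>_def by (metis cis_Arg norm_zero sgn_div_norm div_by_1 scaleR_one inverse_1 zero_neq_one)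
    have "\<theta> \<noteq> 0" using eq_1[of s] s(3) \<rho>s by auto
    have \<theta>: "\<bar>\<theta>\<bar> < pi / (3 * real n)" using B(3) s(2) by (simp add: \<theta>_def)
    \<comment> \<open>The \<open>j\<close>-th multiple of \<open>s\<close>, that is, its
      \<open>j\<close>-th power in multiplicative notation.\<close>
    define p where "p j = ((+) s ^^ j) 0" for j
    have p0: "p 0 = 0" and pS: "p (Suc j) = s + p j" for j by (simp_all add: p_def)
    have \<rho>p: "\<rho> (p j) = cis (real j * \<theta>)" for j
    proof (induction j)
      case (Suc j)
      then show ?case using mult[OF s1, of "p j"] by (simp add: pS \<rho>s cis_mult algebra_simps)
    qed (simp add: p0 zero)
    have nt: "0 < real n * \<bar>\<theta>\<bar>" using n \<open>\<theta> \<noteq> 0\<close> by simp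
    then obtain j0 where "pi / 3 < real j0 * (real n * \<bar>\<theta>\<bar>)" using reals_Archimedean3 by blast
    then have ex: "pi / 3 \<le> real j0 * (real n * \<bar>\<theta>\<bar>)" by simp
    define j where "j = (LEAST j. pi / 3 \<le> real j * (real n * \<bar>\<theta>\<bar>))"
    have j: "pi / 3 \<le> real j * (real n * \<bar>\<theta>\<bar>)" unfolding j_def by (rule LeastI[of _ j0]) (rule ex)
    have less: "real i * (real n * \<bar>\<theta>\<bar>) < pi / 3" if "i < j" for i
      using not_less_Least[of i] that unfolding j_def by (meson not_le)
    obtain l where l: "j = Suc l" using j pi_gt_zero by (cases j) auto
    have pW: "i < j \<Longrightarrow> p i \<in> W" for i
    proof (induction i)
      case (Suc i)
      \<comment> \<open>A step from \<open>W\<close> lands in \<open>K\<close>, and there closeness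
        of \<rho> to 1 forces the point back into \<open>W\<close>.\<close>
      then have "p (Suc i) \<in> K" using WW[OF s(1), of "p i"] O'(3) by (auto simp: pS)
      moreover have "cmod (\<rho> (p (Suc i)) - 1) < c"
      proof -
        have "cmod (\<rho> (p (Suc i)) - 1) \<le> real (Suc i) * \<bar>\<theta>\<bar>"
          unfolding \<rho>p using cmod_cis_minus_1_le[of "real (Suc i) * \<theta>"] by (simp add: abs_mult)
        also have "\<dots> < pi / (3 * real n)"
          using less[OF Suc.prems] n(2) by (simp add: field_simps)
        also have "\<dots> < c" using n \<open>0 < c\<close> by (simp add: field_simps)
        finally show ?thesis .
      qed
      ultimately show ?case using c by force
    qed (simp add: p0 W)
    \<comment> \<open>The stopping point itself may lie outside \<open>W\<close>; its predecessor
      \<open>p l\<close> is in \<open>W\<close>, which puts \<open>p j\<close> into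
      \<open>M\<close>.\<close>
    have "p j \<in> M" using WW[OF s(1) pW[of l]] by (simp add: l pS)
    moreover have "1 \<le> cmod (\<rho> (p j) ^ n - 1)"
    proof -
      have "\<rho> (p j) ^ n = cis (real n * (real j * \<theta>))" unfolding \<rho>p by (rule Complex.DeMoivre)
      moreover have "\<bar>real n * (real j * \<theta>)\<bar> = real j * (real n * \<bar>\<theta>\<bar>)" by (simp add: abs_mult)
      \<comment> \<open>A single step adds less than \<open>pi / 3\<close> to the angle, so the
        first value past \<open>pi / 3\<close> is below \<open>2 * pi / 3\<close> and has not
        wrapped round the circle.\<close>
      moreover have "real j * (real n * \<bar>\<theta>\<bar>) \<le> pi"
      proof -
        have "real n * \<bar>\<theta>\<bar> < pi / 3" using \<theta> n(2) by (simp add: field_simps)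
        moreover have "real j * (real n * \<bar>\<theta>\<bar>) = real l * (real n * \<bar>\<theta>\<bar>) + real n * \<bar>\<theta>\<bar>"
          by (simp add: l algebra_simps)
        ultimately show ?thesis using less[of l] l pi_gt_zero by linarith
      qed
      ultimately show ?thesis using j by (simp add: cmod_cis_minus_1_ge)
    qed
    ultimately show ?thesis by blast
  qed
  then show ?thesis by blast
qed

end

section \<open>Translations of sets and Haar measure\<close>

lemma integrable_complex_indicator:
  assumes "A \<in> sets \<mu>" "emeasure \<mu> A < \<infinity>"
  shows "integrable \<mu> (indicator A :: _ \<Rightarrow> complex)"
proof -
  have "(indicator A :: _ \<Rightarrow> complex) = (\<lambda>r. of_real (indicator A r))"
    by (auto simp: indicator_def)
  then show ?thesis using assms by (simp del: of_real_indicator)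
qed

lemma left_haar_measure_D:
  fixes \<mu> :: "'a::{topological_group_add,t2_space} measure"
  assumes "left_haar_measure \<mu>"
  shows left_haar_sets: "sets \<mu> = sets borel"
    and left_haar_space: "space \<mu> = UNIV"
    and left_haar_translate: "A \<in> sets borel \<Longrightarrow> emeasure \<mu> ((+) s ` A) = emeasure \<mu> A"
    and left_haar_outer: "A \<in> sets borel \<Longrightarrow> emeasure \<mu> A = (INF U\<in>{U. open U \<and> A \<subseteq> U}. emeasure \<mu> U)"
    and left_haar_inner: "open U \<Longrightarrow> emeasure \<mu> U = (SUP K\<in>{K. compact K \<and> K \<subseteq> U}. emeasure \<mu> K)"
proof -
  show sets: "sets \<mu> = sets borel"
    by (rule assms[unfolded left_haar_measure_def, THEN conjunct1])
  show "space \<mu> = UNIV"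
    using sets_eq_imp_space_eq[OF sets] by simp
  note conjs = assms[unfolded left_haar_measure_def, THEN conjunct2, THEN conjunct2]
  show "A \<in> sets borel \<Longrightarrow> emeasure \<mu> ((+) s ` A) = emeasure \<mu> A"
    by (rule conjs[THEN conjunct1, rule_format])
  show "A \<in> sets borel \<Longrightarrow> emeasure \<mu> A = (INF U\<in>{U. open U \<and> A \<subseteq> U}. emeasure \<mu> U)"
    by (rule conjs[THEN conjunct2, THEN conjunct2, THEN conjunct1, rule_format])
  show "open U \<Longrightarrow> emeasure \<mu> U = (SUP K\<in>{K. compact K \<and> K \<subseteq> U}. emeasure \<mu> K)"
    by (rule conjs[THEN conjunct2, THEN conjunct2, THEN conjunct2, rule_format])
qed

lemma translate_eq_vimage: "(+) s ` A = (+) (- s) -` (A :: 'a::group_add set)"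
proof -
  have "x = s + (- s + x)" for x by (simp add: add.assoc[symmetric])
  then show ?thesis by (force simp: add.assoc[symmetric])
qed

lemma borel_measurable_translate: "(+) s \<in> borel_measurable (borel :: 'a::topological_group_add measure)"
  by (intro borel_measurable_continuous_onI) (simp add: continuous_on_def tendsto_intros)

lemma translate_in_borel:
  "A \<in> sets borel \<Longrightarrow> (+) s ` (A :: 'a::topological_group_add set) \<in> sets borel"
  using measurable_sets[OF borel_measurable_translate, of A "- s"] by (simp add: translate_eq_vimage)

lemma left_haar_distr:
  fixes \<mu> :: "'a::{topological_group_add,t2_space} measure"
  assumes "left_haar_measure \<mu>" shows "distr \<mu> \<mu> ((+) s) = \<mu>"
proof (rule measure_eqI)
  note [simp] = left_haar_sets[OF assms] left_haar_space[OF assms]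
  fix A assume "A \<in> sets (distr \<mu> \<mu> ((+) s))"
  then have A: "A \<in> sets borel" by simp
  have "(+) s \<in> measurable \<mu> \<mu>"
    using borel_measurable_translate[of s] by (simp cong: measurable_cong_sets)
  then have "emeasure (distr \<mu> \<mu> ((+) s)) A = emeasure \<mu> ((+) s -` A)"
    using A by (simp add: emeasure_distr)
  also have "(+) s -` A = (+) (- s) ` A" by (simp add: translate_eq_vimage)
  finally show "emeasure (distr \<mu> \<mu> ((+) s)) A = emeasure \<mu> A"
    using left_haar_translate[OF assms A] by simp
qed simp

lemma left_haar_integral_translate:
  fixes \<mu> :: "'a::{topological_group_add,t2_space} measure" and f :: "'a \<Rightarrow> complex"
  assumes "left_haar_measure \<mu>" "f \<in> borel_measurable borel"
  shows "(\<integral>r. f (s + r) \<partial>\<mu>) = (\<integral>r. f r \<partial>\<mu>)"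
proof -
  have "(\<integral>r. f r \<partial>distr \<mu> \<mu> ((+) s)) = (\<integral>r. f (s + r) \<partial>\<mu>)"
    using assms(2) borel_measurable_translate[of s] left_haar_sets[OF assms(1)]
    by (intro integral_distr) (simp_all cong: measurable_cong_sets)
  then show ?thesis by (simp add: left_haar_distr[OF assms(1)])
qed

text \<open>The tube lemma for the open preimage of \<open>U\<close> under addition, which contains
  the slice \<open>{0} \<times> K\<close>.\<close>

lemma ex_open_translate_subset:
  fixes K :: "'a::{topological_group_add,t2_space} set"
  assumes K: "compact K" and U: "open U" "K \<subseteq> U"
  obtains V where "open V" "0 \<in> V" "\<And>s. s \<in> V \<Longrightarrow> (+) s ` K \<subseteq> U"
proof -
  let ?P = "(\<lambda>p::'a \<times> 'a. fst p + snd p) -` U"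
  have "continuous_on UNIV (\<lambda>p::'a \<times> 'a. fst p + snd p)"
    by (simp add: continuous_on_def tendsto_intros)
  then have P: "open ?P" using U(1) by (rule open_vimage[rotated])
  have "{0} \<times> K \<subseteq> ?P" using U(2) by auto
  from Elementary_Topology.tube_lemma[OF K P this]
  obtain V where V: "0 \<in> V" "open V" "V \<times> K \<subseteq> ?P" by (elim exE conjE)
  show ?thesis
  proof (rule that[OF V(2,1)])
    show "(+) s ` K \<subseteq> U" if "s \<in> V" for s
      using V(3) that by (auto simp: subset_eq)
  qed
qed

text \<open>The regularity of the measure replaces the density of \<open>C\<^sub>c\<close> in \<open>L\<^sup>1\<close>: squeeze \<open>A\<close> between a compact
  \<open>K\<close> and an open \<open>U\<close> up to small measure; \<open>s + K\<close> stays inside \<open>U\<close> for small \<open>s\<close>.\<close>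

lemma left_haar_translate_diff_small:
  fixes \<mu> :: "'a::{topological_group_add,t2_space} measure"
  assumes \<mu>: "left_haar_measure \<mu>" and A: "A \<in> sets borel" "emeasure \<mu> A < \<infinity>" and e: "0 < e"
  obtains V where "open V" "0 \<in> V" "\<And>s. s \<in> V \<Longrightarrow> measure \<mu> ((+) s ` A - A) < e"
proof -
  note [simp] = left_haar_sets[OF \<mu>] left_haar_space[OF \<mu>]
  define d where "d = ennreal (e / 3)"
  have d: "0 < d" "d < \<infinity>" using e by (simp_all add: d_def)
  have "0 < e / 3" using e by simp
  have "emeasure \<mu> A \<noteq> \<infinity>" using A(2) by simp
  then obtain U where U: "open U" "A \<subseteq> U" "emeasure \<mu> U < emeasure \<mu> A + d"
    using INF_approx_ennreal[OF \<open>0 < e / 3\<close> left_haar_outer[OF \<mu> A(1)]] by (auto simp: d_def)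
  have U_fin: "emeasure \<mu> U < \<infinity>" using U(3) A(2) d(2) by (simp add: less_trans)
  have UA: "emeasure \<mu> (U - A) \<le> d"
    using A U U_fin by (subst emeasure_Diff) (auto simp: ennreal_minus_le_iff less_imp_le)
  \<comment> \<open>Inner regularity is given for open sets, so \<open>K\<close> approximates
    \<open>U\<close> rather than \<open>A\<close>; it need not lie inside \<open>A\<close>.\<close>
  have "{K. compact K \<and> K \<subseteq> U} \<noteq> {}" by (auto intro: compact_empty)
  moreover have "emeasure \<mu> U \<noteq> \<infinity>" using U_fin by simp
  ultimately obtain K where K: "compact K" "K \<subseteq> U" "emeasure \<mu> U < emeasure \<mu> K + d"
    using SUP_approx_ennreal[OF \<open>0 < e / 3\<close> _ left_haar_inner[OF \<mu> U(1)]] by (auto simp: d_def)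
  have K_borel: "K \<in> sets borel" using K(1) by (simp add: borel_compact)
  have UK: "emeasure \<mu> (U - K) \<le> d"
    using K_borel K U U_fin le_less_trans[OF emeasure_mono[OF K(2), of \<mu>] U_fin]
    by (subst emeasure_Diff) (auto simp: ennreal_minus_le_iff less_imp_le)
  obtain V where V: "open V" "0 \<in> V" "\<And>s. s \<in> V \<Longrightarrow> (+) s ` K \<subseteq> U"
    using ex_open_translate_subset[OF K(1) U(1) K(2)] by blast
  have "measure \<mu> ((+) s ` A - A) < e" if "s \<in> V" for s
  proof -
    \<comment> \<open>A point of \<open>A\<close> either lies in \<open>K\<close>, and then its
      translate stays in \<open>U\<close>, or lies in \<open>U - K\<close>. Both error sets have
      measure at most \<open>e / 3\<close>.\<close>
    have "(+) s ` A - A \<subseteq> (+) s ` (U - K) \<union> (U - A)"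
      using V(3)[OF that] U(2) by auto
    then have "emeasure \<mu> ((+) s ` A - A) \<le> emeasure \<mu> ((+) s ` (U - K) \<union> (U - A))"
      using U(1) K_borel A by (intro emeasure_mono) (auto intro!: sets.Un translate_in_borel)
    also have "\<dots> \<le> emeasure \<mu> ((+) s ` (U - K)) + emeasure \<mu> (U - A)"
      using U(1) K_borel A by (intro emeasure_subadditive) (auto intro!: translate_in_borel)
    also have "\<dots> \<le> d + d"
      using UK UA U(1) K_borel by (intro add_mono) (simp_all add: left_haar_translate[OF \<mu>])
    finally have "emeasure \<mu> ((+) s ` A - A) \<le> ennreal (2 * (e / 3))"
      using e by (simp add: d_def flip: ennreal_plus)
    then have "measure \<mu> ((+) s ` A - A) \<le> 2 * (e / 3)"
      unfolding measure_def using e by (intro enn2real_leI) auto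
    then show ?thesis using e by simp
  qed
  then show ?thesis using V that by blast
qed

section \<open>Decay of integrals against powers\<close>

context adapted_function
begin

context
  fixes \<mu> :: "'a measure"
  assumes haar: "left_haar_measure \<mu>"
    and lc: "locally_compact_space (euclidean :: 'a topology)"
    and nondiscrete: "\<not> open {0 :: 'a}"
begin

lemma power_borel_measurable: "(\<lambda>r. \<rho> r ^ n) \<in> borel_measurable borel"
  using borel_measurable_continuous_onI[OF cont] by simp

lemma cmod_power_le_1: "cmod (\<rho> r ^ n) \<le> 1"
  using le_1 by (simp add: norm_power power_le_one)

lemma norm_1_closed: "closed {r. cmod (\<rho> r) = 1}"
  using cont by (intro closed_Collect_eq continuous_intros)

lemma integrable_mult_power:
  assumes "integrable \<mu> f"
  shows "integrable \<mu> (\<lambda>r. f r * \<rho> r ^ n)"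
proof (rule Bochner_Integration.integrable_bound[OF assms])
  show "(\<lambda>r. f r * \<rho> r ^ n) \<in> borel_measurable \<mu>"
    using assms power_borel_measurable[of n] left_haar_sets[OF haar]
    by (intro borel_measurable_times) (simp_all cong: measurable_cong_sets)
  have "cmod (f r) * cmod (\<rho> r ^ n) \<le> cmod (f r) * 1" for r
    by (intro mult_left_mono cmod_power_le_1) simp
  then show "AE r in \<mu>. cmod (f r * \<rho> r ^ n) \<le> cmod (f r)"
    by (simp add: norm_mult)
qed

text \<open>Translating by \<open>s\<close> with \<open>\<bar>\<rho> s\<bar> = 1\<close> multiplies the integral of \<open>\<rho>\<^sup>n\<close> by \<open>(\<rho> s)\<^sup>n\<close>, but changes the
  domain of integration only slightly.\<close>

lemma cmod_integral_power_translate: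
  assumes A: "A \<in> sets borel" "emeasure \<mu> A < \<infinity>" and s: "cmod (\<rho> s) = 1"
  shows "cmod (\<rho> s ^ n - 1) * cmod (\<integral>r. indicator A r * \<rho> r ^ n \<partial>\<mu>)
    \<le> measure \<mu> ((+) s ` A - A) + measure \<mu> (A - (+) s ` A)"
proof -
  note [simp] = left_haar_sets[OF haar] left_haar_space[OF haar]
  let ?B = "(+) s ` A"
  have B: "?B \<in> sets borel" "emeasure \<mu> ?B < \<infinity>"
    using A by (simp_all add: translate_in_borel left_haar_translate[OF haar])
  have fin: "emeasure \<mu> (?B - A) < \<infinity>" "emeasure \<mu> (A - ?B) < \<infinity>"
    using le_less_trans[OF emeasure_mono[of "?B - A" ?B \<mu>] B(2)]
      le_less_trans[OF emeasure_mono[of "A - ?B" A \<mu>] A(2)] A(1) B(1) by auto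
  have int: "integrable \<mu> (\<lambda>r. indicator C r * \<rho> r ^ n)" if "C \<in> sets borel" "emeasure \<mu> C < \<infinity>" for C
    using that by (intro integrable_mult_power integrable_complex_indicator) simp_all
  have "\<rho> s ^ n * (\<integral>r. indicator A r * \<rho> r ^ n \<partial>\<mu>) = (\<integral>r. indicator A r * (\<rho> s * \<rho> r) ^ n \<partial>\<mu>)"
    by (simp add: power_mult_distrib mult.left_commute[of "indicator A _"])
  also have "\<dots> = (\<integral>r. indicator ?B (s + r) * \<rho> (s + r) ^ n \<partial>\<mu>)"
    using mult[OF s] by (intro Bochner_Integration.integral_cong) (auto simp: indicator_def)
  also have "\<dots> = (\<integral>r. indicator ?B r * \<rho> r ^ n \<partial>\<mu>)"
    using B power_borel_measurable by (intro left_haar_integral_translate[OF haar]) simp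
  finally have "(\<rho> s ^ n - 1) * (\<integral>r. indicator A r * \<rho> r ^ n \<partial>\<mu>)
      = (\<integral>r. indicator ?B r * \<rho> r ^ n \<partial>\<mu>) - (\<integral>r. indicator A r * \<rho> r ^ n \<partial>\<mu>)"
    by (simp add: algebra_simps)
  also have "\<dots> = (\<integral>r. indicator ?B r * \<rho> r ^ n - indicator A r * \<rho> r ^ n \<partial>\<mu>)"
    using int A B by simp
  finally have "cmod (\<rho> s ^ n - 1) * cmod (\<integral>r. indicator A r * \<rho> r ^ n \<partial>\<mu>)
      = cmod (\<integral>r. indicator ?B r * \<rho> r ^ n - indicator A r * \<rho> r ^ n \<partial>\<mu>)"
    by (simp flip: norm_mult)
  also have "\<dots> \<le> (\<integral>r. cmod (indicator ?B r * \<rho> r ^ n - indicator A r * \<rho> r ^ n) \<partial>\<mu>)"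
    by (rule integral_norm_bound)
  also have "\<dots> \<le> (\<integral>r. indicat_real (?B - A) r + indicat_real (A - ?B) r \<partial>\<mu>)"
  proof (rule integral_mono)
    show "integrable \<mu> (\<lambda>r. cmod (indicator ?B r * \<rho> r ^ n - indicator A r * \<rho> r ^ n))"
      using int A B by simp
    show "integrable \<mu> (\<lambda>r. indicat_real (?B - A) r + indicat_real (A - ?B) r)"
      using A B fin by simp
    show "cmod (indicator ?B r * \<rho> r ^ n - indicator A r * \<rho> r ^ n)
        \<le> indicat_real (?B - A) r + indicat_real (A - ?B) r" for r
      using cmod_power_le_1[of r n] by (cases "r \<in> A"; cases "r \<in> ?B") simp_all
  qed
  also have "\<dots> = measure \<mu> (?B - A) + measure \<mu> (A - ?B)"
    using A B fin by simp
  finally show ?thesis .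
qed

text \<open>By invariance both sides are the measure of \<open>A\<close> minus that of the
  intersection of \<open>A\<close> with its translate.\<close>

lemma measure_diff_translate:
  assumes A: "A \<in> sets borel" "emeasure \<mu> A < \<infinity>"
  shows "measure \<mu> (A - (+) s ` A) = measure \<mu> ((+) s ` A - A)"
proof -
  note [simp] = left_haar_sets[OF haar] left_haar_space[OF haar]
  have B: "(+) s ` A \<in> sets borel" "emeasure \<mu> ((+) s ` A) = emeasure \<mu> A"
    using A by (simp_all add: translate_in_borel left_haar_translate[OF haar])
  have "measure \<mu> (C - D) = measure \<mu> C - measure \<mu> (C \<inter> D)"
    if "C \<in> sets borel" "D \<in> sets borel" "emeasure \<mu> C < \<infinity>" for C D
  proof -
    have "C - D = C - C \<inter> D" by blast
    then show ?thesis using that by (simp add: measure_Diff)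
  qed
  then show ?thesis using A B by (simp add: Int_commute measure_def)
qed

lemma tendsto_integral_indicator_power:
  assumes A: "A \<in> sets borel" "emeasure \<mu> A < \<infinity>"
  shows "(\<lambda>n. \<integral>r. indicator A r * \<rho> r ^ n \<partial>\<mu>) \<longlonglongrightarrow> 0"
proof (cases "\<exists>M. open M \<and> 0 \<in> M \<and> (\<forall>r\<in>M. cmod (\<rho> r) = 1)")
  case True
  then obtain M where M: "open M" "0 \<in> M" "\<And>r. r \<in> M \<Longrightarrow> cmod (\<rho> r) = 1" by blast
  show ?thesis
  proof (rule LIMSEQ_I)
    fix e :: real assume "0 < e"
    then have "0 < e / 2" by simp
    from left_haar_translate_diff_small[OF haar A this]
    obtain V where V: "open V" "0 \<in> V" "\<And>s. s \<in> V \<Longrightarrow> measure \<mu> ((+) s ` A - A) < e / 2"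
      by blast
    \<comment> \<open>In \<open>M \<inter> V\<close> the chosen \<open>s\<close> has modulus 1 under
      \<rho> and also moves \<open>A\<close> very little; each half of the symmetric difference has
      measure below \<open>e / 2\<close>.\<close>
    obtain n0 where n0: "\<forall>n\<ge>n0. \<exists>s\<in>M \<inter> V. 1 \<le> cmod (\<rho> s ^ n - 1)"
      using ex_power_far_from_1[OF lc nondiscrete open_Int[OF M(1) V(1)]] M(2,3) V(2) by blast
    have "cmod (\<integral>r. indicator A r * \<rho> r ^ n \<partial>\<mu>) < e" if n: "n \<ge> n0" for n
    proof -
      obtain s where s: "s \<in> M" "s \<in> V" "1 \<le> cmod (\<rho> s ^ n - 1)" using n0 n by blast
      have "1 * cmod (\<integral>r. indicator A r * \<rho> r ^ n \<partial>\<mu>)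
          \<le> cmod (\<rho> s ^ n - 1) * cmod (\<integral>r. indicator A r * \<rho> r ^ n \<partial>\<mu>)"
        using s(3) by (intro mult_right_mono) simp_all
      then show ?thesis
        using cmod_integral_power_translate[OF A M(3)[OF s(1)], of n]
          measure_diff_translate[OF A, of s] V(3)[OF s(2)] by linarith
    qed
    then show "\<exists>n0. \<forall>n\<ge>n0. cmod ((\<integral>r. indicator A r * \<rho> r ^ n \<partial>\<mu>) - 0) < e" by auto
  qed
next
  case False
  note [simp] = left_haar_sets[OF haar] left_haar_space[OF haar]
  define A' where "A' = A \<inter> {r. cmod (\<rho> r) = 1}"
  have A': "A' \<in> sets borel" using A(1) norm_1_closed by (auto simp: A'_def)
  have A'_fin: "emeasure \<mu> A' < \<infinity>"
    using le_less_trans[OF emeasure_mono[of A' A \<mu>] A(2)] A(1) by (simp add: A'_def)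
  have "measure \<mu> A' < e" if e: "0 < e" for e
  proof -
    obtain V where V: "open V" "0 \<in> V" "\<And>s. s \<in> V \<Longrightarrow> measure \<mu> ((+) s ` A' - A') < e"
      using left_haar_translate_diff_small[OF haar A' A'_fin e] by blast
    \<comment> \<open>In this case no neighbourhood of \<open>0\<close> lies in the subgroup where
      \<rho> has modulus 1. Translation by an \<open>s\<close> outside the subgroup moves it to a
      disjoint coset, hence moves \<open>A'\<close> off itself.\<close>
    then obtain s where s: "s \<in> V" "cmod (\<rho> s) \<noteq> 1" using False by blast
    have "(+) s ` A' \<inter> A' = {}"
    proof (rule ccontr)
      assume "(+) s ` A' \<inter> A' \<noteq> {}"
      then obtain a where "cmod (\<rho> a) = 1" "cmod (\<rho> (s + a)) = 1" by (auto simp: A'_def)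
      then have "cmod (\<rho> (s + a + - a)) = 1"
        using mult[of "s + a" "- a"] minus[of a] by (simp add: norm_mult)
      then show False using s(2) by (simp add: add.assoc)
    qed
    then have "(+) s ` A' - A' = (+) s ` A'" by blast
    then show ?thesis using V(3)[OF s(1)] left_haar_translate[OF haar A', of s] by (simp add: measure_def)
  qed
  \<comment> \<open>If the measure were positive, it would be smaller than itself.\<close>
  from this[of "measure \<mu> A'"] have "measure \<mu> A' = 0"
    using measure_nonneg[of \<mu> A'] by linarith
  then have "emeasure \<mu> A' = 0" using A'_fin by (simp add: emeasure_eq_ennreal_measure)
  then have AE: "AE r in \<mu>. r \<notin> A'" using A' by (intro AE_not_in) (simp add: null_sets_def)
  have "(\<lambda>n. \<integral>r. indicator A r * \<rho> r ^ n \<partial>\<mu>) \<longlonglongrightarrow> (\<integral>r. 0 \<partial>\<mu>)"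
  proof (rule integral_dominated_convergence[where w = "indicat_real A"])
    show "AE r in \<mu>. (\<lambda>n. indicator A r * \<rho> r ^ n) \<longlonglongrightarrow> 0"
      using AE
    proof eventually_elim
      case (elim r)
      show ?case
      proof (cases "r \<in> A")
        case True
        then have "cmod (\<rho> r) < 1" using elim le_1[of r] by (auto simp: A'_def)
        then show ?thesis using True by (simp add: LIMSEQ_power_zero)
      qed simp
    qed
    show "AE r in \<mu>. cmod (indicator A r * \<rho> r ^ n) \<le> indicat_real A r" for n
      using cmod_power_le_1 by (intro AE_I2) (simp add: indicator_def)
    show "(\<lambda>r. indicator A r * \<rho> r ^ n) \<in> borel_measurable \<mu>" for n
      using A by (intro borel_measurable_integrable integrable_mult_power integrable_complex_indicator) simp_all
  qed (use A in simp_all)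
  then show ?thesis by simp
qed

text \<open>Since \<open>\<rho> r ^ n\<close> has modulus at most 1, integration against it is
  \<open>L^1\<close>-contractive uniformly in \<open>n\<close>, so convergence passes from
  indicators to all integrable functions.\<close>

lemma tendsto_integral_power:
  assumes "integrable \<mu> f"
  shows "(\<lambda>n. \<integral>r. f r * \<rho> r ^ n \<partial>\<mu>) \<longlonglongrightarrow> 0"
  using assms
proof (induction rule: integrable_induct)
  case (base A c)
  then have "A \<in> sets borel" using left_haar_sets[OF haar] by simp
  then have "(\<lambda>n. c * (\<integral>r. indicator A r * \<rho> r ^ n \<partial>\<mu>)) \<longlonglongrightarrow> 0"
    using base by (intro tendsto_mult_right_zero tendsto_integral_indicator_power)
  moreover have "(\<integral>r. indicator A r *\<^sub>R c * \<rho> r ^ n \<partial>\<mu>) = c * (\<integral>r. indicator A r * \<rho> r ^ n \<partial>\<mu>)" for n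
    unfolding integral_mult_right_zero[symmetric]
    by (intro Bochner_Integration.integral_cong) (simp_all add: indicator_def)
  ultimately show ?case by simp
next
  case (add f g)
  then show ?case
    using tendsto_add[OF add.IH] by (simp add: ring_distribs integrable_mult_power)
next
  case (lim f s)
  have f: "f \<in> borel_measurable \<mu>" and s: "\<And>i. s i \<in> borel_measurable \<mu>"
    using lim by auto
  have L1: "(\<lambda>i. \<integral>r. cmod (s i r - f r) \<partial>\<mu>) \<longlonglongrightarrow> (\<integral>r. 0 \<partial>\<mu>)"
  \<comment> \<open>The simple approximants satisfy
    \<open>cmod (s i r) \<le> 2 * cmod (f r)\<close>, whence the factor 3.\<close>
  proof (rule integral_dominated_convergence[where w = "\<lambda>r. 3 * cmod (f r)"])
    show "AE r in \<mu>. (\<lambda>i. cmod (s i r - f r)) \<longlonglongrightarrow> 0"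
      using lim by (intro AE_I2) (simp add: LIM_zero tendsto_norm_zero)
    show "AE r in \<mu>. norm (cmod (s i r - f r)) \<le> 3 * cmod (f r)" for i
    proof (rule AE_I2)
      fix r assume "r \<in> space \<mu>"
      then have "cmod (s i r) \<le> 2 * cmod (f r)" using lim by blast
      then show "norm (cmod (s i r - f r)) \<le> 3 * cmod (f r)"
        using norm_triangle_ineq4[of "s i r" "f r"] by simp
    qed
  qed (use f s lim in simp_all)
  show ?case
  proof (rule LIMSEQ_I)
    fix e :: real assume "0 < e"
    then obtain i where i: "(\<integral>r. cmod (s i r - f r) \<partial>\<mu>) < e / 2"
      using order_tendstoD(2)[OF L1, of "e / 2"] by (auto dest: eventually_happens)
    obtain N where N: "\<forall>n\<ge>N. cmod (\<integral>r. s i r * \<rho> r ^ n \<partial>\<mu>) < e / 2"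
      using LIMSEQ_D[OF lim.IH[of i], of "e / 2"] \<open>0 < e\<close> by auto
    have "cmod (\<integral>r. f r * \<rho> r ^ n \<partial>\<mu>) < e" if "n \<ge> N" for n
    proof -
      have "(\<integral>r. s i r * \<rho> r ^ n \<partial>\<mu>) - (\<integral>r. f r * \<rho> r ^ n \<partial>\<mu>) = (\<integral>r. (s i r - f r) * \<rho> r ^ n \<partial>\<mu>)"
        using lim by (simp add: ring_distribs integrable_mult_power)
      also have "cmod \<dots> \<le> (\<integral>r. cmod ((s i r - f r) * \<rho> r ^ n) \<partial>\<mu>)"
        by (rule integral_norm_bound)
      also have "\<dots> \<le> (\<integral>r. cmod (s i r - f r) \<partial>\<mu>)"
      proof (rule integral_mono)
        show "integrable \<mu> (\<lambda>r. cmod ((s i r - f r) * \<rho> r ^ n))"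
          using lim by (intro integrable_norm integrable_mult_power) simp
        show "cmod ((s i r - f r) * \<rho> r ^ n) \<le> cmod (s i r - f r)" for r
          using mult_left_mono[OF cmod_power_le_1[of r n], of "cmod (s i r - f r)"] by (simp add: norm_mult)
      qed (use lim in simp)
      finally show ?thesis
        using i N that norm_triangle_sub[of "\<integral>r. f r * \<rho> r ^ n \<partial>\<mu>" "\<integral>r. s i r * \<rho> r ^ n \<partial>\<mu>"]
        by (fastforce simp: norm_minus_commute)
    qed
    then show "\<exists>N. \<forall>n\<ge>N. cmod ((\<integral>r. f r * \<rho> r ^ n \<partial>\<mu>) - 0) < e" by auto
  qed
qed

end

end

section \<open>Weak* convergence\<close>

text \<open>The kernel of the power is a Schur power of the kernel of \<rho>. Already for
  \<open>n = 1\<close> the construction matters: it moves \<rho> from a Hilbert space in an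
  arbitrary type to one of functions on the group.\<close>

lemma P1_power:
  fixes \<rho> :: "'a::topological_group_add \<Rightarrow> complex"
  assumes \<rho>: "\<rho> \<in> P1 TYPE('h::ab_group_add)" and n: "0 < n"
  shows "(\<lambda>r. \<rho> r ^ n) \<in> P1 TYPE('a \<Rightarrow> complex)"
  by (intro P1_if_psd_kernel psd_kernel_power P1_psd_kernel[OF \<rho>] n continuous_intros P1_continuous[OF \<rho>])
    (simp add: P1_zero[OF \<rho>])

lemma P1_in_fourier_stieltjes:
  fixes \<phi> :: "'a::topological_group_add \<Rightarrow> complex"
  assumes "\<phi> \<in> P1 TYPE('a \<Rightarrow> complex)" shows "\<phi> \<in> fourier_stieltjes"
  using assms unfolding P1_def fourier_stieltjes_def matrix_coefficients_def by blast

lemma zero_in_fourier_stieltjes: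
  fixes \<phi> :: "'a::topological_group_add \<Rightarrow> complex"
  assumes "\<phi> \<in> P1 TYPE('a \<Rightarrow> complex)"
  shows "(\<lambda>r::'a. 0) \<in> fourier_stieltjes"
proof -
  obtain scale and H :: "('a \<Rightarrow> complex) set" and ip and \<pi> :: "'a \<Rightarrow> _" and \<xi>
    where rep: "unitary_rep scale H ip \<pi>" and \<xi>: "\<xi> \<in> H"
    using assms unfolding P1_def by blast
  interpret unitary_rep scale H ip \<pi> by (fact rep)
  have "(\<lambda>r. 0) = (\<lambda>r. ip (\<pi> r \<xi>) 0)" using \<xi> by simp
  then show ?thesis
    unfolding fourier_stieltjes_def matrix_coefficients_def using rep \<xi> H_0 by blast
qed

lemma integrable_mult_P1:
  fixes \<phi> :: "'a::topological_group_add \<Rightarrow> complex"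
  assumes \<mu>: "sets \<mu> = sets borel" and f: "integrable \<mu> f" and \<phi>: "\<phi> \<in> P1 TYPE('h::ab_group_add)"
  shows "integrable \<mu> (\<lambda>r. f r * \<phi> r)"
proof -
  obtain scale and H :: "'h set" and ip \<pi> \<xi> where
    rep: "unitary_rep scale H ip \<pi>" and \<xi>: "\<xi> \<in> H" and \<phi>_eq: "\<phi> = (\<lambda>r. ip (\<pi> r \<xi>) \<xi>)"
    using \<phi> unfolding P1_def by blast
  show ?thesis
    unfolding \<phi>_eq by (rule unitary_rep.integrable_coefficient[OF rep \<mu> f \<xi> \<xi>])
qed

lemma cmod_integral_diff_le_cstar_norm:
  fixes \<phi> :: "'a::topological_group_add \<Rightarrow> complex"
  assumes \<mu>: "sets \<mu> = sets borel" and f: "integrable \<mu> f" and g: "integrable \<mu> g"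
    and \<phi>: "\<phi> \<in> P1 TYPE('a \<Rightarrow> complex)"
  shows "cmod ((\<integral>r. f r * \<phi> r \<partial>\<mu>) - (\<integral>r. g r * \<phi> r \<partial>\<mu>)) \<le> cstar_norm \<mu> (\<lambda>r. f r - g r)"
proof -
  have "(\<integral>r. f r * \<phi> r \<partial>\<mu>) - (\<integral>r. g r * \<phi> r \<partial>\<mu>) = (\<integral>r. (f r - g r) * \<phi> r \<partial>\<mu>)"
    using integrable_mult_P1[OF \<mu> f \<phi>] integrable_mult_P1[OF \<mu> g \<phi>] by (simp add: left_diff_distrib)
  then show ?thesis
    using cmod_integral_P1_le_cstar_norm[OF \<mu> _ \<phi>] f g by simp
qed

text \<open>This justifies the definite description in \<open>cstar_pairing\<close>: the bound by
  \<open>cstar_norm\<close> makes the integrals along \<open>F0\<close> Cauchy and gives equivalent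
  sequences the same limit. A nonempty class makes the number unique.\<close>

lemma tendsto_cstar_pairing:
  fixes \<phi> :: "'a::topological_group_add \<Rightarrow> complex"
  assumes \<mu>: "sets \<mu> = sets borel" and \<phi>: "\<phi> \<in> P1 TYPE('a \<Rightarrow> complex)"
    and F0: "F0 \<in> cstar_cauchy \<mu>" and "cstar_equiv \<mu> `` {F0} \<noteq> {}"
  shows "(\<lambda>k. \<integral>r. F0 k r * \<phi> r \<partial>\<mu>) \<longlonglongrightarrow> cstar_pairing \<mu> (cstar_equiv \<mu> `` {F0}) \<phi>"
proof -
  have F0_int: "integrable \<mu> (F0 k)" for k
    using F0 by (simp add: cstar_cauchy_def)
  have "Cauchy (\<lambda>k. \<integral>r. F0 k r * \<phi> r \<partial>\<mu>)"
  proof (rule metric_CauchyI)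
    fix e :: real assume "0 < e"
    then obtain N where N: "\<forall>m\<ge>N. \<forall>n\<ge>N. cstar_norm \<mu> (\<lambda>r. F0 m r - F0 n r) < e"
      using F0 unfolding cstar_cauchy_def by blast
    have "dist (\<integral>r. F0 m r * \<phi> r \<partial>\<mu>) (\<integral>r. F0 n r * \<phi> r \<partial>\<mu>) < e" if "m \<ge> N" "n \<ge> N" for m n
      using cmod_integral_diff_le_cstar_norm[OF \<mu> F0_int F0_int \<phi>, of m n] N that
      unfolding dist_norm by (meson le_less_trans)
    then show "\<exists>N. \<forall>m\<ge>N. \<forall>n\<ge>N. dist (\<integral>r. F0 m r * \<phi> r \<partial>\<mu>) (\<integral>r. F0 n r * \<phi> r \<partial>\<mu>) < e"
      by blast
  qed
  then obtain c where c: "(\<lambda>k. \<integral>r. F0 k r * \<phi> r \<partial>\<mu>) \<longlonglongrightarrow> c"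
    using Cauchy_convergent convergent_def by blast
  have lim: "(\<lambda>k. \<integral>r. F k r * \<phi> r \<partial>\<mu>) \<longlonglongrightarrow> c" if F: "F \<in> cstar_equiv \<mu> `` {F0}" for F
  proof -
    have F_int: "integrable \<mu> (F k)" for k
      using F by (auto simp: cstar_equiv_def cstar_cauchy_def)
    have 0: "(\<lambda>k. cstar_norm \<mu> (\<lambda>r. F0 k r - F k r)) \<longlonglongrightarrow> 0"
      using F by (auto simp: cstar_equiv_def)
    have "(\<lambda>k. (\<integral>r. F0 k r * \<phi> r \<partial>\<mu>) - (\<integral>r. F k r * \<phi> r \<partial>\<mu>)) \<longlonglongrightarrow> 0"
      by (intro Lim_null_comparison[OF _ 0] always_eventually allI
          cmod_integral_diff_le_cstar_norm[OF \<mu> F0_int F_int \<phi>])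
    from tendsto_diff[OF c this] show ?thesis by simp
  qed
  obtain F1 where "F1 \<in> cstar_equiv \<mu> `` {F0}" using assms(4) by blast
  then have "cstar_pairing \<mu> (cstar_equiv \<mu> `` {F0}) \<phi> = c"
    unfolding cstar_pairing_def using lim LIMSEQ_unique by (intro the_equality) blast+
  then show ?thesis using c by simp
qed

lemma cstar_pairing_zero:
  assumes "x \<noteq> {}" shows "cstar_pairing \<mu> x (\<lambda>r. 0) = 0"
  using assms by (auto simp: cstar_pairing_def LIMSEQ_const_iff)

text \<open>An exchange of limits: all \<open>\<phi> n\<close> with \<open>0 < n\<close> have norm
  at most 1 as functionals, so one \<open>F K\<close> approximates the pairing uniformly in
  \<open>n\<close>.\<close>

lemma tendsto_cstar_pairing_0:
  fixes \<phi> :: "nat \<Rightarrow> 'a::topological_group_add \<Rightarrow> complex"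
  assumes \<mu>: "sets \<mu> = sets borel" and \<phi>: "\<And>n. 0 < n \<Longrightarrow> \<phi> n \<in> P1 TYPE('a \<Rightarrow> complex)"
    and lim: "\<And>f. integrable \<mu> f \<Longrightarrow> (\<lambda>n. \<integral>r. f r * \<phi> n r \<partial>\<mu>) \<longlonglongrightarrow> 0"
    and x: "x \<in> group_cstar \<mu>"
  shows "(\<lambda>n. cstar_pairing \<mu> x (\<phi> n)) \<longlonglongrightarrow> cstar_pairing \<mu> x (\<lambda>r. 0)"
proof (cases "x = {}")
  case True
  \<comment> \<open>On an empty class the description has the same unspecified value for every
    function, so the sequence is constant.\<close>
  then show ?thesis by (simp add: cstar_pairing_def)
next
  case False
  obtain F where F: "F \<in> cstar_cauchy \<mu>" and x_eq: "x = cstar_equiv \<mu> `` {F}"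
    using x unfolding group_cstar_def by (auto elim: quotientE)
  have F_int: "integrable \<mu> (F k)" for k
    using F by (simp add: cstar_cauchy_def)
  have "(\<lambda>n. cstar_pairing \<mu> x (\<phi> n)) \<longlonglongrightarrow> 0"
  proof (rule LIMSEQ_I)
    fix e :: real assume "0 < e"
    then have "0 < e / 2" by simp
    then obtain K where K: "\<forall>m\<ge>K. \<forall>n\<ge>K. cstar_norm \<mu> (\<lambda>r. F m r - F n r) < e / 2"
      using F unfolding cstar_cauchy_def by blast
    obtain N where N: "\<forall>n\<ge>N. cmod (\<integral>r. F K r * \<phi> n r \<partial>\<mu>) < e / 2"
      using LIMSEQ_D[OF lim[OF F_int[of K]] \<open>0 < e / 2\<close>] by auto
    \<comment> \<open>\<open>Suc N\<close> ensures \<open>0 < n\<close>, where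
      \<open>\<phi> n\<close> is known to be in \<open>P1\<close>.\<close>
    have "cmod (cstar_pairing \<mu> x (\<phi> n)) < e" if n: "n \<ge> Suc N" for n
    proof -
      have \<phi>n: "\<phi> n \<in> P1 TYPE('a \<Rightarrow> complex)" using \<phi> n by simp
      have "(\<lambda>k. cmod ((\<integral>r. F k r * \<phi> n r \<partial>\<mu>) - (\<integral>r. F K r * \<phi> n r \<partial>\<mu>)))
          \<longlonglongrightarrow> cmod (cstar_pairing \<mu> x (\<phi> n) - (\<integral>r. F K r * \<phi> n r \<partial>\<mu>))"
        using tendsto_cstar_pairing[OF \<mu> \<phi>n F] False unfolding x_eq by (intro tendsto_intros) simp
      moreover have "cmod ((\<integral>r. F k r * \<phi> n r \<partial>\<mu>) - (\<integral>r. F K r * \<phi> n r \<partial>\<mu>)) \<le> e / 2" if "k \<ge> K" for k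
        using cmod_integral_diff_le_cstar_norm[OF \<mu> F_int F_int \<phi>n, of k K] K that
        by (meson less_imp_le order_refl order_trans)
      ultimately have "cmod (cstar_pairing \<mu> x (\<phi> n) - (\<integral>r. F K r * \<phi> n r \<partial>\<mu>)) \<le> e / 2"
        by (intro LIMSEQ_le_const2) auto
      then show ?thesis
        using N[rule_format, of n] n
          norm_triangle_sub[of "cstar_pairing \<mu> x (\<phi> n)" "\<integral>r. F K r * \<phi> n r \<partial>\<mu>"] by simp
    qed
    then show "\<exists>N. \<forall>n\<ge>N. cmod (cstar_pairing \<mu> x (\<phi> n) - 0) < e" by auto
  qed
  then show ?thesis using cstar_pairing_zero[OF False] by simp
qed

text \<open>Membership in \<open>A\<close> is asked only eventually because \<open>P1_power\<close>
  covers positive exponents, while the sequence in the theorem starts at exponent 0.\<close>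

lemma limitin_pullback_topology:
  assumes "l \<in> A" "eventually (\<lambda>n. f n \<in> A) F" "limitin T (\<lambda>n. g (f n)) (g l) F"
  shows "limitin (pullback_topology A g T) f l F"
  unfolding limitin_def
proof (intro conjI allI impI)
  show "l \<in> topspace (pullback_topology A g T)"
    using assms limitin_topspace[OF assms(3)] by (simp add: topspace_pullback_topology)
  fix S assume S: "openin (pullback_topology A g T) S \<and> l \<in> S"
  then obtain U where U: "openin T U" "S = g -` U \<inter> A"
    by (auto simp: openin_pullback_topology)
  then have "eventually (\<lambda>n. g (f n) \<in> U) F"
    using assms(3) S by (auto simp: limitin_def)
  with assms(2) show "eventually (\<lambda>n. f n \<in> S) F"
    by eventually_elim (simp add: U(2))
qed

text \<open>Translations carry an open \<open>{0}\<close> to every singleton, which would make the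
  topology discrete.\<close>

lemma not_open_zero_if_not_discrete:
  assumes "(euclidean :: 'a::topological_group_add topology) \<noteq> discrete_topology UNIV"
  shows "\<not> open {0 :: 'a}"
proof
  assume 0: "open {0 :: 'a}"
  have "open {x}" for x :: 'a
  proof -
    have "continuous_on UNIV ((+) (- x))"
      by (simp add: continuous_on_def tendsto_intros)
    then have "open ((+) (- x) -` {0})"
      using 0 by (rule open_vimage[rotated])
    also have "(+) (- x) -` {0} = {x}"
      by (auto simp: neg_eq_iff_add_eq_0[symmetric])
    finally show ?thesis .
  qed
  then have "open (\<Union>x\<in>S. {x})" for S :: "'a set"
    by blast
  then have "open S" for S :: "'a set"
    by simp
  then show False using assms by (simp add: topology_eq)
qed

theorem theorem3:
  fixes \<mu> :: "'a::{topological_group_add,t2_space} measure"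
    and \<rho> :: "'a \<Rightarrow> complex"
  assumes "locally_compact_space (euclidean :: 'a topology)"
    and "(euclidean :: 'a topology) \<noteq> discrete_topology UNIV"
    and "left_haar_measure \<mu>"
    and "\<rho> \<in> P1 TYPE('h::ab_group_add)"
    and "adapted \<rho>"
  shows "limitin (weak_star_topology \<mu>) (\<lambda>n r. \<rho> r ^ n) (\<lambda>r. 0) sequentially"
proof -
  interpret adapted_function \<rho>
  proof
    show "\<rho> r = 1 \<Longrightarrow> r = 0" for r
      using assms(5) unfolding adapted_def by blast
  qed (fact P1_D[OF assms(4)] | rule P1_D[OF assms(4)])+
  have P1: "(\<lambda>r. \<rho> r ^ n) \<in> P1 TYPE('a \<Rightarrow> complex)" if "0 < n" for n
    using P1_power[OF assms(4) that] .
  show ?thesis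
    unfolding weak_star_topology_def
  proof (rule limitin_pullback_topology)
    show "(\<lambda>r. 0) \<in> (fourier_stieltjes :: ('a \<Rightarrow> complex) set)"
      using zero_in_fourier_stieltjes[OF P1[of 1]] by simp
    show "\<forall>\<^sub>F n in sequentially. (\<lambda>r. \<rho> r ^ n) \<in> fourier_stieltjes"
      using eventually_gt_at_top[of 0]
      by eventually_elim (intro P1_in_fourier_stieltjes P1)
    have "(\<lambda>n. cstar_pairing \<mu> x (\<lambda>r. \<rho> r ^ n)) \<longlonglongrightarrow> cstar_pairing \<mu> x (\<lambda>r. 0)"
      if "x \<in> group_cstar \<mu>" for x
      using left_haar_sets[OF assms(3)] P1
        tendsto_integral_power[OF assms(3,1) not_open_zero_if_not_discrete[OF assms(2)]] that
      by (rule tendsto_cstar_pairing_0)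
    then show "limitin (product_topology (\<lambda>_. euclidean) (group_cstar \<mu>))
        (\<lambda>n. \<lambda>x\<in>group_cstar \<mu>. cstar_pairing \<mu> x (\<lambda>r. \<rho> r ^ n))
        (\<lambda>x\<in>group_cstar \<mu>. cstar_pairing \<mu> x (\<lambda>r. 0)) sequentially"
      by (simp add: limitin_componentwise)
  qed
qed

end
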